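(* Let $(M,\varphi,\xi,\eta,g)$ be an almost contact B-metric manifold. The torsion of the $\varphi$-canonical connection is invariant with respect to a general contact conformal transformation (i.e. $\overline T''=T''$ as $(1,2)$-tensors, where $T''$ and $\overline T''$ are the torsions of the $\varphi$-canonical connections of $(M,\varphi,\xi,\eta,g)$ and of its image $(M,\varphi,\overline\xi,\overline\eta,\overline g)$) if and only if the transformation belongs to the group $G_0$.
   Context: An almost contact B-metric manifold $(M,\varphi,\xi,\eta,g)$ is a $(2n+1)$-dimensional manifold with an endomorphism $\varphi$ of $TM$, a vector field $\xi$, a 1-form $\eta$ and a pseudo-Riemannian metric $g$ of signature $(n+1,n)$ with $\varphi\xi=0$, $\varphi^2=-I+\eta\otimes\xi$, $\eta\circ\varphi=0$, $\eta(\xi)=1$, $g(\varphi x,\varphi y)=-g(x,y)+\eta(x)\eta(y)$. An affine connection $\nabla^*$ is natural if $\nabla^*\varphi=0$, $\nabla^*\xi=0$, $\nabla^*\eta=0$, $\nabla^*g=0$. A natural connection $\nabla''$ with torsion $T''$, $T''(x,y,z)=g(T''(x,y),z)$, is called a $\varphi$-canonical connection if \begin{align*} &T''(x,y,z)-T''(x,\varphi y,\varphi z)-T''(x,z,y)+T''(x,\varphi z,\varphi y)\\ &-\eta(x)\{T''(\xi,y,z)-T''(\xi,\varphi y,\varphi z)-T''(\xi,z,y)+T''(\xi,\varphi z,\varphi y)\}\\ &-\eta(y)\{T''(x,\xi,z)-T''(x,z,\xi)-\eta(x)T''(z,\xi,\xi)\}\\ &+\eta(z)\{T''(x,\xi,y)-T''(x,y,\xi)-\eta(x)T''(y,\xi,\xi)\}=0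 . \end{align*} It exists and is unique on every almost contact B-metric manifold; explicitly, with $\nabla$ the Levi-Civita connection of $g$, $F(x,y,z)=g((\nabla_x\varphi)y,z)$ and $N(x,y,z)=g(N(x,y),z)$, $N=[\varphi,\varphi]+d\eta\otimes\xi$, where $[\varphi,\varphi](x,y)=[\varphi x,\varphi y]+\varphi^2[x,y]-\varphi[\varphi x,y]-\varphi[x,\varphi y]$ and $d\eta(x,y)=(\nabla_x\eta)y-(\nabla_y\eta)x$, one has $g(\nabla''_xy-\nabla_xy,z)=\frac12\{F(x,\varphi y,z)+\eta(z)F(x,\varphi y,\xi)-2\eta(y)F(x,\varphi z,\xi)\}-\frac18\{N(\varphi^2z,\varphi^2y,\varphi^2x)+2N(\varphi z,\varphi y,\xi)\eta(x)\}$. A general contact conformal transformation is given by differentiable functions $u,v,w$ on $M$: $\overline\xi=e^{-w}\xi$, $\overline\eta=e^{w}\eta$, $\overline g(x,y)=\alpha g(x,y)+\beta g(x,\varphi y)+(\gamma-\alpha)\eta(x)\eta(y)$ with $\alpha=e^{2u}\cos 2v$, $\beta=e^{2u}\sin 2v$, $\gamma=e^{2w}$; these form a group $G$. The subgroup $G_0\subset G$ is defined by the conditions $du\circ\varphi^2+dv\circ\varphi=0$, $du\circ\varphi-dv\circ\varphi^2=0$, $du(\xi)=0$, $dv(\xi)=0$, $dw\circ\varphi=0$. *)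

theory Defs
  imports "HOL-Analysis.Analysis" "HOL-Library.Function_Algebras"
begin

text \<open>
  The sums, differences, products and zeros of functions below are the pointwise ones
  of \<^theory>\<open>HOL-Library.Function_Algebras\<close>.
\<close>

section \<open>Smooth manifolds\<close>

text \<open>
  For open \<open>S\<close>, \<open>Ck_on k S f\<close> says that \<open>f\<close> is \<open>k\<close> times continuously differentiable on \<open>S\<close>,
  by recursion on all directional derivatives.
\<close>

primrec Ck_on :: "nat \<Rightarrow> 'e::euclidean_space set \<Rightarrow> ('e \<Rightarrow> 'f::real_normed_vector) \<Rightarrow> bool" where
  "Ck_on 0 S f \<longleftrightarrow> continuous_on S f"
| "Ck_on (Suc k) S f \<longleftrightarrow>
     (\<forall>x\<in>S. f differentiable (at x)) \<and>
     (\<forall>v. Ck_on k S (\<lambda>x. frechet_derivative f (at x) v))"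

definition smooth_on :: "'e::euclidean_space set \<Rightarrow> ('e \<Rightarrow> 'f::real_normed_vector) \<Rightarrow> bool" where
  "smooth_on S f \<longleftrightarrow> (\<forall>k. Ck_on k S f)"

text \<open>
  The manifold is the whole type \<open>'a\<close> with its Hausdorff, second countable topology; a chart is
  a pair of an open domain and a coordinate map, and an atlas need not be maximal.
\<close>

type_synonym ('a, 'e) atlas = "('a set \<times> ('a \<Rightarrow> 'e)) set"

definition smooth_atlas ::
    "('a::{t2_space, second_countable_topology}, 'e::euclidean_space) atlas \<Rightarrow> bool" where
  "smooth_atlas A \<longleftrightarrow>
     (\<Union>(U, \<psi>)\<in>A. U) = UNIV \<and>
     (\<forall>(U, \<psi>)\<in>A. open U \<and> open (\<psi> ` U) \<and> homeomorphism U (\<psi> ` U) \<psi> (inv_into U \<psi>)) \<and>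
     (\<forall>(U, \<psi>)\<in>A. \<forall>(V, \<kappa>)\<in>A. smooth_on (\<psi> ` (U \<inter> V)) (\<kappa> \<circ> inv_into U \<psi>))"

definition smooth_fns :: "('a, 'e::euclidean_space) atlas \<Rightarrow> ('a \<Rightarrow> real) set" where
  "smooth_fns A = {f. \<forall>(U, \<psi>)\<in>A. smooth_on (\<psi> ` U) (f \<circ> inv_into U \<psi>)}"

text \<open>
  Smooth vector fields are the derivations of the algebra of smooth functions: \<open>X f p\<close> is the
  derivative of \<open>f\<close> at \<open>p\<close> in the direction of the tangent vector \<open>X\<^sub>p\<close>. The value on non-smooth
  functions is fixed to be zero, so that equality of vector fields is equality in HOL.
\<close>

type_synonym 'a vfield = "('a \<Rightarrow> real) \<Rightarrow> 'a \<Rightarrow> real"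

definition vfields :: "('a, 'e::euclidean_space) atlas \<Rightarrow> 'a vfield set" where
  "vfields A = {X.
     (\<forall>f\<in>smooth_fns A. X f \<in> smooth_fns A) \<and>
     (\<forall>f\<in>smooth_fns A. \<forall>h\<in>smooth_fns A. X (f + h) = X f + X h) \<and>
     (\<forall>f\<in>smooth_fns A. \<forall>c::real. X (\<lambda>p. c * f p) = (\<lambda>p. c * X f p)) \<and>
     (\<forall>f\<in>smooth_fns A. \<forall>h\<in>smooth_fns A. X (f * h) = X f * h + f * X h) \<and>
     (\<forall>f. f \<notin> smooth_fns A \<longrightarrow> X f = 0)}"

definition vscale :: "('a \<Rightarrow> real) \<Rightarrow> 'a vfield \<Rightarrow> 'a vfield" (infixr \<open>\<odot>\<close> 75) where
  "f \<odot> X = (\<lambda>h. f * X h)"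

definition lie_bracket :: "'a vfield \<Rightarrow> 'a vfield \<Rightarrow> 'a vfield" where
  "lie_bracket X Y = (\<lambda>f. X (Y f) - Y (X f))"

definition differential :: "('a \<Rightarrow> real) \<Rightarrow> 'a vfield \<Rightarrow> 'a \<Rightarrow> real" where
  "differential f X = X f"


section \<open>Tensor fields, metrics and connections\<close>

text \<open>
  Tensor fields are maps on vector fields that are linear over the smooth functions. They are
  constrained only on \<^const>\<open>vfields\<close>, and are only ever compared there.
\<close>

type_synonym 'a one_form = "'a vfield \<Rightarrow> 'a \<Rightarrow> real"
type_synonym 'a endo = "'a vfield \<Rightarrow> 'a vfield"
type_synonym 'a bilin = "'a vfield \<Rightarrow> 'a vfield \<Rightarrow> 'a \<Rightarrow> real"
type_synonym 'a connection = "'a vfield \<Rightarrow> 'a vfield \<Rightarrow> 'a vfield"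

definition is_one_form :: "('a, 'e::euclidean_space) atlas \<Rightarrow> 'a one_form \<Rightarrow> bool" where
  "is_one_form A \<eta> \<longleftrightarrow>
     (\<forall>X\<in>vfields A. \<eta> X \<in> smooth_fns A) \<and>
     (\<forall>X\<in>vfields A. \<forall>Y\<in>vfields A. \<eta> (X + Y) = \<eta> X + \<eta> Y) \<and>
     (\<forall>f\<in>smooth_fns A. \<forall>X\<in>vfields A. \<eta> (f \<odot> X) = f * \<eta> X)"

definition is_endo :: "('a, 'e::euclidean_space) atlas \<Rightarrow> 'a endo \<Rightarrow> bool" where
  "is_endo A \<phi> \<longleftrightarrow>
     (\<forall>X\<in>vfields A. \<phi> X \<in> vfields A) \<and>
     (\<forall>X\<in>vfields A. \<forall>Y\<in>vfields A. \<phi> (X + Y) = \<phi> X + \<phi> Y) \<and>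
     (\<forall>f\<in>smooth_fns A. \<forall>X\<in>vfields A. \<phi> (f \<odot> X) = f \<odot> \<phi> X)"

text \<open>
  Linearity in the second argument of the metric follows from symmetry. In the signature clause the
  frame \<open>E\<close> is pseudo-orthonormal at \<open>p\<close>, hence linearly independent there; it is a basis
  of the tangent space at \<open>p\<close> when \<open>r + s\<close> is the dimension of the manifold.
\<close>

definition pseudo_riemannian_metric ::
    "('a, 'e::euclidean_space) atlas \<Rightarrow> nat \<Rightarrow> nat \<Rightarrow> 'a bilin \<Rightarrow> bool" where
  "pseudo_riemannian_metric A r s g \<longleftrightarrow>
     DIM('e) = r + s \<and>
     (\<forall>Y\<in>vfields A. is_one_form A (\<lambda>X. g X Y)) \<and>
     (\<forall>X\<in>vfields A. \<forall>Y\<in>vfields A. g X Y = g Y X) \<and>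
     (\<forall>p. \<forall>X\<in>vfields A. (\<forall>Y\<in>vfields A. g X Y p = 0) \<longrightarrow> (\<forall>f\<in>smooth_fns A. X f p = 0)) \<and>
     (\<forall>p. \<exists>E::nat \<Rightarrow> 'a vfield. (\<forall>i<r + s. E i \<in> vfields A) \<and>
        (\<forall>i<r + s. \<forall>j<r + s.
           g (E i) (E j) p = (if i \<noteq> j then 0 else if i < r then 1 else - 1)))"

definition affine_connection :: "('a, 'e::euclidean_space) atlas \<Rightarrow> 'a connection \<Rightarrow> bool" where
  "affine_connection A D \<longleftrightarrow>
     (\<forall>X\<in>vfields A. \<forall>Y\<in>vfields A. D X Y \<in> vfields A) \<and>
     (\<forall>X\<in>vfields A. \<forall>Y\<in>vfields A. \<forall>Z\<in>vfields A. D (X + Y) Z = D X Z + D Y Z) \<and>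
     (\<forall>f\<in>smooth_fns A. \<forall>X\<in>vfields A. \<forall>Y\<in>vfields A. D (f \<odot> X) Y = f \<odot> D X Y) \<and>
     (\<forall>X\<in>vfields A. \<forall>Y\<in>vfields A. \<forall>Z\<in>vfields A. D X (Y + Z) = D X Y + D X Z) \<and>
     (\<forall>f\<in>smooth_fns A. \<forall>X\<in>vfields A. \<forall>Y\<in>vfields A. D X (f \<odot> Y) = X f \<odot> Y + f \<odot> D X Y)"

definition torsion :: "'a connection \<Rightarrow> 'a vfield \<Rightarrow> 'a vfield \<Rightarrow> 'a vfield" where
  "torsion D X Y = D X Y - D Y X - lie_bracket X Y"

text \<open>\<open>cov_endo D \<phi> X Y\<close> is \<open>(D\<^sub>X \<phi>) Y\<close>, and similarly for the other covariant derivatives.\<close>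

definition cov_endo :: "'a connection \<Rightarrow> 'a endo \<Rightarrow> 'a vfield \<Rightarrow> 'a vfield \<Rightarrow> 'a vfield" where
  "cov_endo D \<phi> X Y = D X (\<phi> Y) - \<phi> (D X Y)"

definition cov_form :: "'a connection \<Rightarrow> 'a one_form \<Rightarrow> 'a vfield \<Rightarrow> 'a vfield \<Rightarrow> 'a \<Rightarrow> real" where
  "cov_form D \<eta> X Y = X (\<eta> Y) - \<eta> (D X Y)"

definition cov_bilin ::
    "'a connection \<Rightarrow> 'a bilin \<Rightarrow> 'a vfield \<Rightarrow> 'a vfield \<Rightarrow> 'a vfield \<Rightarrow> 'a \<Rightarrow> real" where
  "cov_bilin D g X Y Z = X (g Y Z) - g (D X Y) Z - g Y (D X Z)"

definition levi_civita :: "('a, 'e::euclidean_space) atlas \<Rightarrow> 'a bilin \<Rightarrow> 'a connection \<Rightarrow> bool" where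
  "levi_civita A g D \<longleftrightarrow>
     affine_connection A D \<and>
     (\<forall>X\<in>vfields A. \<forall>Y\<in>vfields A. torsion D X Y = 0) \<and>
     (\<forall>X\<in>vfields A. \<forall>Y\<in>vfields A. \<forall>Z\<in>vfields A. cov_bilin D g X Y Z = 0)"


section \<open>Almost contact B-metric manifolds\<close>

definition almost_contact_B_metric ::
    "('a::{t2_space, second_countable_topology}, 'e::euclidean_space) atlas \<Rightarrow> nat \<Rightarrow>
     'a endo \<Rightarrow> 'a vfield \<Rightarrow> 'a one_form \<Rightarrow> 'a bilin \<Rightarrow> bool" where
  "almost_contact_B_metric A n \<phi> \<xi> \<eta> g \<longleftrightarrow>
     smooth_atlas A \<and> DIM('e) = 2 * n + 1 \<and>
     is_endo A \<phi> \<and> \<xi> \<in> vfields A \<and> is_one_form A \<eta> \<and>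
     pseudo_riemannian_metric A (n + 1) n g \<and>
     \<phi> \<xi> = 0 \<and>
     (\<forall>X\<in>vfields A. \<phi> (\<phi> X) = - X + \<eta> X \<odot> \<xi>) \<and>
     (\<forall>X\<in>vfields A. \<eta> (\<phi> X) = 0) \<and>
     \<eta> \<xi> = 1 \<and>
     (\<forall>X\<in>vfields A. \<forall>Y\<in>vfields A. g (\<phi> X) (\<phi> Y) = - g X Y + \<eta> X * \<eta> Y)"

definition natural_connection ::
    "('a, 'e::euclidean_space) atlas \<Rightarrow> 'a endo \<Rightarrow> 'a vfield \<Rightarrow> 'a one_form \<Rightarrow> 'a bilin \<Rightarrow>
     'a connection \<Rightarrow> bool" where
  "natural_connection A \<phi> \<xi> \<eta> g D \<longleftrightarrow>
     affine_connection A D \<and>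
     (\<forall>X\<in>vfields A. \<forall>Y\<in>vfields A. cov_endo D \<phi> X Y = 0) \<and>
     (\<forall>X\<in>vfields A. D X \<xi> = 0) \<and>
     (\<forall>X\<in>vfields A. \<forall>Y\<in>vfields A. cov_form D \<eta> X Y = 0) \<and>
     (\<forall>X\<in>vfields A. \<forall>Y\<in>vfields A. \<forall>Z\<in>vfields A. cov_bilin D g X Y Z = 0)"

definition phi_canonical_torsion ::
    "('a, 'e::euclidean_space) atlas \<Rightarrow> 'a endo \<Rightarrow> 'a vfield \<Rightarrow> 'a one_form \<Rightarrow> 'a bilin \<Rightarrow>
     'a connection \<Rightarrow> bool" where
  "phi_canonical_torsion A \<phi> \<xi> \<eta> g D \<longleftrightarrow>
     (let T = (\<lambda>X Y Z. g (torsion D X Y) Z) in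
      \<forall>x\<in>vfields A. \<forall>y\<in>vfields A. \<forall>z\<in>vfields A.
        T x y z - T x (\<phi> y) (\<phi> z) - T x z y + T x (\<phi> z) (\<phi> y)
        - \<eta> x * (T \<xi> y z - T \<xi> (\<phi> y) (\<phi> z) - T \<xi> z y + T \<xi> (\<phi> z) (\<phi> y))
        - \<eta> y * (T x \<xi> z - T x z \<xi> - \<eta> x * T z \<xi> \<xi>)
        + \<eta> z * (T x \<xi> y - T x y \<xi> - \<eta> x * T y \<xi> \<xi>) = 0)"

definition fundamental_tensor ::
    "'a connection \<Rightarrow> 'a endo \<Rightarrow> 'a bilin \<Rightarrow> 'a vfield \<Rightarrow> 'a vfield \<Rightarrow> 'a vfield \<Rightarrow> 'a \<Rightarrow> real" where
  "fundamental_tensor L \<phi> g X Y Z = g (cov_endo L \<phi> X Y) Z"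

definition nijenhuis_phi :: "'a endo \<Rightarrow> 'a vfield \<Rightarrow> 'a vfield \<Rightarrow> 'a vfield" where
  "nijenhuis_phi \<phi> X Y =
     lie_bracket (\<phi> X) (\<phi> Y) + \<phi> (\<phi> (lie_bracket X Y))
     - \<phi> (lie_bracket (\<phi> X) Y) - \<phi> (lie_bracket X (\<phi> Y))"

definition d_form :: "'a connection \<Rightarrow> 'a one_form \<Rightarrow> 'a vfield \<Rightarrow> 'a vfield \<Rightarrow> 'a \<Rightarrow> real" where
  "d_form L \<eta> X Y = cov_form L \<eta> X Y - cov_form L \<eta> Y X"

definition nijenhuis_tensor ::
    "'a connection \<Rightarrow> 'a endo \<Rightarrow> 'a vfield \<Rightarrow> 'a one_form \<Rightarrow> 'a vfield \<Rightarrow> 'a vfield \<Rightarrow> 'a vfield" where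
  "nijenhuis_tensor L \<phi> \<xi> \<eta> X Y = nijenhuis_phi \<phi> X Y + d_form L \<eta> X Y \<odot> \<xi>"

definition phi_canonical_formula ::
    "('a, 'e::euclidean_space) atlas \<Rightarrow> 'a endo \<Rightarrow> 'a vfield \<Rightarrow> 'a one_form \<Rightarrow> 'a bilin \<Rightarrow>
     'a connection \<Rightarrow> 'a connection \<Rightarrow> bool" where
  "phi_canonical_formula A \<phi> \<xi> \<eta> g L D \<longleftrightarrow>
     (let F = fundamental_tensor L \<phi> g;
          N = (\<lambda>X Y Z. g (nijenhuis_tensor L \<phi> \<xi> \<eta> X Y) Z) in
      \<forall>x\<in>vfields A. \<forall>y\<in>vfields A. \<forall>z\<in>vfields A. \<forall>p.
        g (D x y - L x y) z p =
          1 / 2 * (F x (\<phi> y) z p + \<eta> z p * F x (\<phi> y) \<xi> p - 2 * \<eta> y p * F x (\<phi> z) \<xi> p)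
          - 1 / 8 * (N (\<phi> (\<phi> z)) (\<phi> (\<phi> y)) (\<phi> (\<phi> x)) p + 2 * N (\<phi> z) (\<phi> y) \<xi> p * \<eta> x p))"

text \<open>
  The torsion identity does not involve the part of \<open>D \<xi> y\<close>, for \<open>y\<close> with \<open>\<eta> y = 0\<close>, that is
  skew-symmetric for \<open>g\<close> and commutes with \<open>\<phi>\<close>. This part is zero for \<open>n = 1\<close>, but for \<open>n > 1\<close>
  the identity alone does not determine the connection. The explicit expression through the
  Levi-Civita connection \<open>L\<close> does so; the connection it describes is natural and satisfies
  the identity.
\<close>

definition phi_canonical_connection ::
    "('a, 'e::euclidean_space) atlas \<Rightarrow> 'a endo \<Rightarrow> 'a vfield \<Rightarrow> 'a one_form \<Rightarrow> 'a bilin \<Rightarrow>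
     'a connection \<Rightarrow> bool" where
  "phi_canonical_connection A \<phi> \<xi> \<eta> g D \<longleftrightarrow>
     natural_connection A \<phi> \<xi> \<eta> g D \<and>
     phi_canonical_torsion A \<phi> \<xi> \<eta> g D \<and>
     (\<exists>L. levi_civita A g L \<and> phi_canonical_formula A \<phi> \<xi> \<eta> g L D)"


section \<open>General contact conformal transformations\<close>

definition conf_xi :: "('a \<Rightarrow> real) \<Rightarrow> 'a vfield \<Rightarrow> 'a vfield" where
  "conf_xi w \<xi> = (\<lambda>p. exp (- w p)) \<odot> \<xi>"

definition conf_eta :: "('a \<Rightarrow> real) \<Rightarrow> 'a one_form \<Rightarrow> 'a one_form" where
  "conf_eta w \<eta> = (\<lambda>X p. exp (w p) * \<eta> X p)"

definition conf_metric ::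
    "('a \<Rightarrow> real) \<Rightarrow> ('a \<Rightarrow> real) \<Rightarrow> ('a \<Rightarrow> real) \<Rightarrow> 'a endo \<Rightarrow> 'a one_form \<Rightarrow> 'a bilin \<Rightarrow> 'a bilin" where
  "conf_metric u v w \<phi> \<eta> g =
     (let \<alpha> = (\<lambda>p. exp (2 * u p) * cos (2 * v p));
          \<beta> = (\<lambda>p. exp (2 * u p) * sin (2 * v p));
          \<gamma> = (\<lambda>p. exp (2 * w p)) in
      (\<lambda>X Y. \<alpha> * g X Y + \<beta> * g X (\<phi> Y) + (\<gamma> - \<alpha>) * \<eta> X * \<eta> Y))"

definition in_G0 ::
    "('a, 'e::euclidean_space) atlas \<Rightarrow> 'a endo \<Rightarrow> 'a vfield \<Rightarrow>
     ('a \<Rightarrow> real) \<Rightarrow> ('a \<Rightarrow> real) \<Rightarrow> ('a \<Rightarrow> real) \<Rightarrow> bool" where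
  "in_G0 A \<phi> \<xi> u v w \<longleftrightarrow>
     (\<forall>X\<in>vfields A. differential u (\<phi> (\<phi> X)) + differential v (\<phi> X) = 0) \<and>
     (\<forall>X\<in>vfields A. differential u (\<phi> X) - differential v (\<phi> (\<phi> X)) = 0) \<and>
     differential u \<xi> = 0 \<and> differential v \<xi> = 0 \<and>
     (\<forall>X\<in>vfields A. differential w (\<phi> X) = 0)"

end

theory Submission
  imports Defs
begin

text \<open>
  Let \<open>Q = D' - D\<close> be the difference of the two connections, and call a field horizontal if \<open>\<eta>\<close>
  vanishes on it. The torsions agree if and only if \<open>Q\<close> is symmetric. On horizontal fields
  \<open>\<phi>\<close> is a complex structure, \<open>g X Y - \<i> g X (\<phi> Y)\<close> is a complex bilinear metric, and the new
  metric arises from it by the complex conformal factor \<open>exp (2 (u + \<i> v))\<close>. Naturality of both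
  connections makes \<open>Q X\<close> commute with \<open>\<phi>\<close>, gives \<open>Q X \<xi> = X w \<odot> \<xi>\<close>, and shows that the part of
  \<open>Q X\<close> that is symmetric for the complex metric is the multiplication by the derivative of
  \<open>u + \<i> v\<close> along \<open>X\<close> (lemma \<open>Q_metric\<close>).

  If \<open>Q\<close> is symmetric, it is complex linear in its first argument too. Then so is the derivative
  of \<open>u + \<i> v\<close>, which is the main condition defining the group: the Cauchy-Riemann equations. The
  other conditions follow from \<open>Q X \<xi> = Q \<xi> X\<close>. This direction is \<open>in_G0_if_symmetric\<close>.

  Conversely, there is exactly one tensor on horizontal fields that is symmetric in its first two
  arguments and has the symmetric part prescribed above; in the group it is complex trilinear. The
  deviation of \<open>Q\<close> from it is a skew form satisfying the torsion identity of the canonical connections,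
  since this identity is the same for both metrics, and linear algebra makes such a form vanish
  (\<open>skew_form_with_torsion_identity_vanishes\<close>, \<open>horizontal_symmetric\<close>). The identity leaves \<open>Q \<xi>\<close>
  open. There the explicit formula for the canonical connection simplifies to an expression
  in derivatives and Lie brackets along \<open>\<xi>\<close> (\<open>canonical_xi\<close>), and transformations in the group do not
  affect it (\<open>canonical_xi_unchanged\<close>).

  Everything is computed with global vector fields, which are derivations. The derivatives of
  the conformal factors need a chain rule, obtained from power series
  in \<open>vf_power_sum_at_zero\<close>.
\<close>


section \<open>Smooth functions of a Euclidean variable\<close>

lemma Ck_on_cong:
  assumes "open S" "\<And>x. x \<in> S \<Longrightarrow> f x = g x" "Ck_on k S f"
  shows "Ck_on k S g"
  using assms(2,3)
proof (induction k arbitrary: f g)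
  case 0
  then show ?case by (simp cong: continuous_on_cong)
next
  case (Suc k)
  have f: "f differentiable at x" if "x \<in> S" for x
    using Suc.prems that by simp
  have "g differentiable at x" if "x \<in> S" for x
    using f[OF that] Suc.prems(1) assms(1) that
    by (meson differentiable_def has_derivative_transform_within_open)
  moreover have "Ck_on k S (\<lambda>x. frechet_derivative g (at x) v)" for v
  proof (rule Suc.IH[of "\<lambda>x. frechet_derivative f (at x) v"])
    show "frechet_derivative f (at x) v = frechet_derivative g (at x) v" if "x \<in> S" for x
      using frechet_derivative_transform_within_open[OF f[OF that] assms(1) that Suc.prems(1)]
      by simp
  qed (use Suc.prems in simp)
  ultimately show ?case by simp
qed

lemma Ck_on_decrease: "Ck_on (Suc k) S f \<Longrightarrow> Ck_on k S f"
proof (induction k arbitrary: f)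
  case 0
  then show ?case
    by (simp add: continuous_at_imp_continuous_on differentiable_imp_continuous_within)
next
  case (Suc k)
  then show ?case by (metis Ck_on.simps(2))
qed

text \<open>The derivatives of a function have to be known on the open set only, which is how the
  closure properties below recognise them.\<close>

lemma Ck_on_SucI:
  assumes "open S" "\<And>x. x \<in> S \<Longrightarrow> (f has_derivative f' x) (at x)"
    and "\<And>v. Ck_on k S (\<lambda>x. f' x v)"
  shows "Ck_on (Suc k) S f"
proof -
  have "Ck_on k S (\<lambda>x. frechet_derivative f (at x) v)" for v
    by (rule Ck_on_cong[OF assms(1) _ assms(3)[of v]])
      (use frechet_derivative_at[OF assms(2)] in simp)
  then show ?thesis
    using assms(2) by (auto simp: differentiable_def)
qed

lemma Ck_on_SucD:
  assumes "Ck_on (Suc k) S f"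
  shows "x \<in> S \<Longrightarrow> (f has_derivative frechet_derivative f (at x)) (at x)"
    and "Ck_on k S (\<lambda>x. frechet_derivative f (at x) v)"
  using assms by (simp_all add: frechet_derivative_works)

lemma Ck_on_const: "open S \<Longrightarrow> Ck_on k S (\<lambda>x. c :: real)"
proof (induction k arbitrary: c)
  case (Suc k)
  show ?case
    using Suc by (intro Ck_on_SucI[where f' = "\<lambda>x v. 0"] has_derivative_const)
qed simp

lemma Ck_on_add:
  fixes f g :: "'e::euclidean_space \<Rightarrow> real"
  assumes "open S"
  shows "Ck_on k S f \<Longrightarrow> Ck_on k S g \<Longrightarrow> Ck_on k S (\<lambda>x. f x + g x)"
proof (induction k arbitrary: f g)
  case (Suc k)
  show ?case
  proof (rule Ck_on_SucI[OF assms])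
    show "((\<lambda>x. f x + g x) has_derivative
        (\<lambda>v. frechet_derivative f (at x) v + frechet_derivative g (at x) v)) (at x)"
      if "x \<in> S" for x
      by (rule has_derivative_add[OF Ck_on_SucD(1)[OF Suc.prems(1) that]
            Ck_on_SucD(1)[OF Suc.prems(2) that]])
    show "Ck_on k S (\<lambda>x. frechet_derivative f (at x) v + frechet_derivative g (at x) v)" for v
      by (rule Suc.IH[OF Ck_on_SucD(2)[OF Suc.prems(1)] Ck_on_SucD(2)[OF Suc.prems(2)]])
  qed
qed (simp add: continuous_on_add)

lemma Ck_on_mult:
  fixes f g :: "'e::euclidean_space \<Rightarrow> real"
  assumes "open S"
  shows "Ck_on k S f \<Longrightarrow> Ck_on k S g \<Longrightarrow> Ck_on k S (\<lambda>x. f x * g x)"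
proof (induction k arbitrary: f g)
  case 0
  then show ?case unfolding Ck_on.simps by (rule continuous_on_mult)
next
  case (Suc k)
  show ?case
  proof (rule Ck_on_SucI[OF assms, where f' =
        "\<lambda>x v. f x * frechet_derivative g (at x) v + frechet_derivative f (at x) v * g x"])
    show "((\<lambda>x. f x * g x) has_derivative
        (\<lambda>v. f x * frechet_derivative g (at x) v + frechet_derivative f (at x) v * g x)) (at x)"
      if "x \<in> S" for x
      by (rule has_derivative_mult[OF Ck_on_SucD(1)[OF Suc.prems(1) that]
            Ck_on_SucD(1)[OF Suc.prems(2) that]])
    show "Ck_on k S (\<lambda>x. f x * frechet_derivative g (at x) v + frechet_derivative f (at x) v * g x)"
      for v
      by (rule Ck_on_add[OF assms
            Suc.IH[OF Ck_on_decrease[OF Suc.prems(1)] Ck_on_SucD(2)[OF Suc.prems(2)]]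
            Suc.IH[OF Ck_on_SucD(2)[OF Suc.prems(1)] Ck_on_decrease[OF Suc.prems(2)]]])
  qed
qed

text \<open>Power series with infinite radius of convergence serve as the functions through which smooth
  functions are composed. They contain the exponential, the sine and the cosine, and beyond its linear
  terms each of them is \<open>x\<^sup>2\<close> times another one.\<close>

definition entire_coeffs :: "(nat \<Rightarrow> real) \<Rightarrow> bool" where
  "entire_coeffs c \<longleftrightarrow> (\<forall>x. summable (\<lambda>n. c n * x ^ n))"

definition power_sum :: "(nat \<Rightarrow> real) \<Rightarrow> real \<Rightarrow> real" where
  "power_sum c x = (\<Sum>n. c n * x ^ n)"

text \<open>Entire series are closed under differentiation, so that the induction over the order of
  differentiability runs over all of them at once.\<close>

lemma Ck_on_power_sum:
  fixes f :: "'e::euclidean_space \<Rightarrow> real"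
  assumes "open S"
  shows "entire_coeffs c \<Longrightarrow> Ck_on k S f \<Longrightarrow> Ck_on k S (\<lambda>x. power_sum c (f x))"
proof (induction k arbitrary: c)
  case 0
  have "isCont (power_sum c) x" for x
    using termdiffs_strong_converges_everywhere[of c x] 0(1)
    unfolding entire_coeffs_def power_sum_def by (blast intro: DERIV_isCont)
  then have "continuous_on UNIV (power_sum c)"
    by (simp add: continuous_on_eq_continuous_within)
  then show ?case
    using 0(2) continuous_on_compose2[of UNIV "power_sum c" S f] by simp
next
  case (Suc k)
  have deriv: "(power_sum c has_field_derivative power_sum (diffs c) y) (at y)" for y
    using termdiffs_strong_converges_everywhere[of c y] Suc.prems(1)
    unfolding entire_coeffs_def power_sum_def by blast
  have entire: "entire_coeffs (diffs c)"
    using Suc.prems(1) termdiff_converges_all[of c] unfolding entire_coeffs_def by blast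
  show ?case
  proof (rule Ck_on_SucI[OF assms, where f' =
        "\<lambda>x v. power_sum (diffs c) (f x) * frechet_derivative f (at x) v"])
    show "((\<lambda>x. power_sum c (f x)) has_derivative
        (\<lambda>v. power_sum (diffs c) (f x) * frechet_derivative f (at x) v)) (at x)"
      if "x \<in> S" for x
      using has_derivative_compose[OF Ck_on_SucD(1)[OF Suc.prems(2) that]
          deriv[of "f x", unfolded has_field_derivative_def]] .
    show "Ck_on k S (\<lambda>x. power_sum (diffs c) (f x) * frechet_derivative f (at x) v)" for v
      by (rule Ck_on_mult[OF assms Suc.IH[OF entire Ck_on_decrease[OF Suc.prems(2)]]
            Ck_on_SucD(2)[OF Suc.prems(2)]])
  qed
qed

lemma entire_coeffs_shift:
  assumes "entire_coeffs c"
  shows "entire_coeffs (\<lambda>n. c (n + 2))"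
  unfolding entire_coeffs_def
proof
  fix x :: real
  show "summable (\<lambda>n. c (n + 2) * x ^ n)"
  proof (cases "x = 0")
    case True
    then show ?thesis by simp
  next
    case False
    have "summable (\<lambda>n. c (n + 2) * x ^ (n + 2))"
      using assms by (intro summable_ignore_initial_segment) (simp add: entire_coeffs_def)
    then have "summable (\<lambda>n. c (n + 2) * x ^ (n + 2) / x ^ 2)"
      by (rule summable_divide)
    then show ?thesis
      using False by (simp add: power_add field_simps)
  qed
qed

lemma power_sum_shift:
  assumes "entire_coeffs c"
  shows "power_sum c x = c 0 + c 1 * x + x * (x * power_sum (\<lambda>n. c (n + 2)) x)"
proof -
  have s: "summable (\<lambda>n. c n * x ^ n)"
    using assms by (simp add: entire_coeffs_def)
  have "power_sum c x = (\<Sum>n. c (n + 2) * x ^ (n + 2)) + (\<Sum>n<2. c n * x ^ n)"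
    unfolding power_sum_def by (rule suminf_split_initial_segment[OF s])
  also have "(\<Sum>n. c (n + 2) * x ^ (n + 2)) = (\<Sum>n. x * x * (c (n + 2) * x ^ n))"
    by (simp add: ac_simps)
  also have "\<dots> = x * x * power_sum (\<lambda>n. c (n + 2)) x"
    unfolding power_sum_def
    by (rule suminf_mult) (use entire_coeffs_shift[OF assms] in \<open>simp add: entire_coeffs_def\<close>)
  also have "(\<Sum>n<2. c n * x ^ n) = c 0 + c 1 * x"
    by (simp add: numeral_2_eq_2)
  finally show ?thesis by (simp only: ac_simps)
qed

lemma exp_eq_power_sum: "exp = power_sum (\<lambda>n. inverse (fact n))"
  and entire_coeffs_exp: "entire_coeffs (\<lambda>n. inverse (fact n))"
  using exp_converges[where 'a = real]
  by (simp_all add: fun_eq_iff power_sum_def entire_coeffs_def sums_iff)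

lemma sin_eq_power_sum: "sin = power_sum sin_coeff"
  and entire_coeffs_sin: "entire_coeffs sin_coeff"
  using sin_converges[where 'a = real]
  by (simp_all add: fun_eq_iff power_sum_def entire_coeffs_def sums_iff)

lemma cos_eq_power_sum: "cos = power_sum cos_coeff"
  and entire_coeffs_cos: "entire_coeffs cos_coeff"
  using cos_converges[where 'a = real]
  by (simp_all add: fun_eq_iff power_sum_def entire_coeffs_def sums_iff)


section \<open>The algebra of smooth functions and its derivations\<close>

locale smooth_manifold =
  fixes A :: "('a::{t2_space, second_countable_topology}, 'e::euclidean_space) atlas"
  assumes atlas: "smooth_atlas A"
begin

abbreviation C where "C \<equiv> smooth_fns A"
abbreviation V where "V \<equiv> vfields A"

lemma open_chart: "(U, \<psi>) \<in> A \<Longrightarrow> open (\<psi> ` U)"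
  using atlas by (auto simp: smooth_atlas_def)

lemma smooth_const: "(\<lambda>p. c) \<in> C"
  by (auto simp: smooth_fns_def smooth_on_def o_def open_chart intro!: Ck_on_const)

lemma smooth_add: "f \<in> C \<Longrightarrow> h \<in> C \<Longrightarrow> f + h \<in> C"
  by (fastforce simp: smooth_fns_def smooth_on_def o_def open_chart intro!: Ck_on_add)

lemma smooth_mult: "f \<in> C \<Longrightarrow> h \<in> C \<Longrightarrow> f * h \<in> C"
  by (fastforce simp: smooth_fns_def smooth_on_def o_def open_chart intro!: Ck_on_mult)

lemma smooth_power_sum: "entire_coeffs c \<Longrightarrow> f \<in> C \<Longrightarrow> (\<lambda>p. power_sum c (f p)) \<in> C"
  by (fastforce simp: smooth_fns_def smooth_on_def o_def open_chart intro!: Ck_on_power_sum)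

lemma smooth_zero: "0 \<in> C"
  using smooth_const[of 0] by (simp add: zero_fun_def)

lemma smooth_one: "1 \<in> C"
  using smooth_const[of 1] by (simp add: one_fun_def)

lemma smooth_cmult: "f \<in> C \<Longrightarrow> (\<lambda>p. c * f p) \<in> C"
  using smooth_mult[OF smooth_const, of f c] by (simp add: times_fun_def)

lemma smooth_uminus: "f \<in> C \<Longrightarrow> - f \<in> C"
  using smooth_cmult[of f "-1"] by (simp add: fun_Compl_def)

lemma smooth_diff: "f \<in> C \<Longrightarrow> h \<in> C \<Longrightarrow> f - h \<in> C"
  using smooth_add[of f "- h"] smooth_uminus by simp

lemma smooth_exp: "f \<in> C \<Longrightarrow> (\<lambda>p. exp (f p)) \<in> C"
  unfolding exp_eq_power_sum by (rule smooth_power_sum[OF entire_coeffs_exp])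

lemma smooth_sin: "f \<in> C \<Longrightarrow> (\<lambda>p. sin (f p)) \<in> C"
  unfolding sin_eq_power_sum by (rule smooth_power_sum[OF entire_coeffs_sin])

lemma smooth_cos: "f \<in> C \<Longrightarrow> (\<lambda>p. cos (f p)) \<in> C"
  unfolding cos_eq_power_sum by (rule smooth_power_sum[OF entire_coeffs_cos])

lemma
  assumes "X \<in> V" "f \<in> C"
  shows vf_smooth: "X f \<in> C"
    and vf_add: "h \<in> C \<Longrightarrow> X (f + h) = X f + X h"
    and vf_cmult: "X (\<lambda>p. c * f p) = (\<lambda>p. c * X f p)"
    and vf_mult: "h \<in> C \<Longrightarrow> X (f * h) = X f * h + f * X h"
  using assms by (auto simp: vfields_def)

lemma vf_off_smooth: "X \<in> V \<Longrightarrow> f \<notin> C \<Longrightarrow> X f = 0"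
  by (auto simp: vfields_def)

lemma vf_const:
  assumes "X \<in> V"
  shows "X (\<lambda>p. c) = 0"
proof -
  have "X 1 = 0"
    using vf_mult[OF assms smooth_one smooth_one] by simp
  then show ?thesis
    using vf_cmult[OF assms smooth_one, of c] by (simp add: fun_eq_iff)
qed

lemma vf_uminus:
  assumes "X \<in> V" "f \<in> C"
  shows "X (- f) = - X f"
  using vf_cmult[OF assms, of "-1"] by (simp add: fun_Compl_def)

lemma vf_diff:
  assumes "X \<in> V" "f \<in> C" "h \<in> C"
  shows "X (f - h) = X f - X h"
  using vf_add[OF assms(1,2) smooth_uminus[OF assms(3)]] vf_uminus[OF assms(1,3)] by simp

lemma vf_add_const:
  assumes "X \<in> V" "f \<in> C"
  shows "X (\<lambda>q. f q + c) = X f"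
  using vf_add[OF assms smooth_const, of c] vf_const[OF assms(1), of c]
  by (simp add: plus_fun_def zero_fun_def)

text \<open>Derivations know only sums and products, so that there is no chain rule to begin with. At a zero
  of \<open>h\<close> the series beyond its linear term is \<open>h\<^sup>2\<close> times a smooth function, and a derivation
  kills it there. For the exponential and the trigonometric functions the addition theorems move
  any point to a zero of the argument.\<close>

lemma vf_power_sum_at_zero:
  assumes X: "X \<in> V" and h: "h \<in> C" and c: "entire_coeffs c" and p: "h p = 0"
  shows "X (\<lambda>q. power_sum c (h q)) p = c 1 * X h p"
proof -
  define r where "r = (\<lambda>q. power_sum (\<lambda>n. c (n + 2)) (h q))"
  have r: "r \<in> C"
    unfolding r_def by (rule smooth_power_sum[OF entire_coeffs_shift[OF c] h])
  define s where "s = h * (h * r) + (\<lambda>q. c 1 * h q)"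
  have s: "s \<in> C"
    unfolding s_def by (intro smooth_add smooth_mult smooth_cmult h r)
  have "(\<lambda>q. power_sum c (h q)) = (\<lambda>q. s q + c 0)"
    by (rule ext) (simp add: power_sum_shift[OF c] r_def s_def)
  then have "X (\<lambda>q. power_sum c (h q)) p = X s p"
    by (simp add: vf_add_const[OF X s])
  also have "X s p = c 1 * X h p"
    by (simp add: s_def vf_add[OF X] vf_mult[OF X] vf_cmult[OF X] h r smooth_mult smooth_cmult p)
  finally show ?thesis .
qed

lemma vf_exp:
  assumes X: "X \<in> V" and f: "f \<in> C"
  shows "X (\<lambda>q. exp (f q)) = (\<lambda>p. exp (f p) * X f p)"
proof
  fix p
  define h where "h = (\<lambda>q. f q + - f p)"
  have h: "h \<in> C"
    using smooth_add[OF f smooth_const[of "- f p"]] by (simp add: h_def plus_fun_def)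
  have "(\<lambda>q. exp (f q)) = (\<lambda>q. exp (f p) * exp (h q))"
    by (simp add: h_def flip: exp_add)
  then have "X (\<lambda>q. exp (f q)) p = exp (f p) * X (\<lambda>q. exp (h q)) p"
    by (simp add: vf_cmult[OF X smooth_exp[OF h]])
  also have "X (\<lambda>q. exp (h q)) p = X h p"
    unfolding exp_eq_power_sum using vf_power_sum_at_zero[OF X h entire_coeffs_exp, of p]
    by (simp add: h_def)
  also have "X h = X f"
    unfolding h_def by (rule vf_add_const[OF X f])
  finally show "X (\<lambda>q. exp (f q)) p = exp (f p) * X f p" .
qed

lemma
  assumes X: "X \<in> V" and f: "f \<in> C"
  shows vf_sin: "X (\<lambda>q. sin (f q)) = (\<lambda>p. cos (f p) * X f p)"
    and vf_cos: "X (\<lambda>q. cos (f q)) = (\<lambda>p. - (sin (f p) * X f p))"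
proof -
  have "X (\<lambda>q. sin (f q)) p = cos (f p) * X f p \<and> X (\<lambda>q. cos (f q)) p = - (sin (f p) * X f p)"
    for p
  proof -
    define h where "h = (\<lambda>q. f q + - f p)"
    have h: "h \<in> C"
      using smooth_add[OF f smooth_const[of "- f p"]] by (simp add: h_def plus_fun_def)
    have hp: "h p = 0"
      by (simp add: h_def)
    have sin_eq: "(\<lambda>q. sin (f q)) =
        (\<lambda>q. sin (f p) * cos (h q)) + (\<lambda>q. cos (f p) * sin (h q))"
      by (rule ext) (simp add: h_def flip: sin_add)
    have cos_eq: "(\<lambda>q. cos (f q)) =
        (\<lambda>q. cos (f p) * cos (h q)) - (\<lambda>q. sin (f p) * sin (h q))"
      by (rule ext) (simp add: h_def flip: cos_add)
    have X_sin: "X (\<lambda>q. sin (h q)) p = X h p"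
      unfolding sin_eq_power_sum using vf_power_sum_at_zero[OF X h entire_coeffs_sin hp]
      by (simp add: sin_coeff_def)
    have X_cos: "X (\<lambda>q. cos (h q)) p = 0"
      unfolding cos_eq_power_sum using vf_power_sum_at_zero[OF X h entire_coeffs_cos hp]
      by (simp add: cos_coeff_def)
    have X_h: "X h = X f"
      unfolding h_def by (rule vf_add_const[OF X f])
    have "X (\<lambda>q. sin (f q)) p = sin (f p) * X (\<lambda>q. cos (h q)) p + cos (f p) * X (\<lambda>q. sin (h q)) p"
      unfolding sin_eq by (simp add: vf_add[OF X] vf_cmult[OF X] h smooth_cmult smooth_sin smooth_cos)
    moreover have
      "X (\<lambda>q. cos (f q)) p = cos (f p) * X (\<lambda>q. cos (h q)) p - sin (f p) * X (\<lambda>q. sin (h q)) p"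
      unfolding cos_eq by (simp add: vf_diff[OF X] vf_cmult[OF X] h smooth_cmult smooth_sin smooth_cos)
    ultimately show ?thesis
      by (simp add: X_sin X_cos X_h)
  qed
  then show "X (\<lambda>q. sin (f q)) = (\<lambda>p. cos (f p) * X f p)"
    and "X (\<lambda>q. cos (f q)) = (\<lambda>p. - (sin (f p) * X f p))"
    by auto
qed

lemma vf_plus_closed: "X \<in> V \<Longrightarrow> Y \<in> V \<Longrightarrow> X + Y \<in> V"
  unfolding vfields_def by (auto simp: fun_eq_iff algebra_simps smooth_add)

lemma vf_scale_closed: "f \<in> C \<Longrightarrow> X \<in> V \<Longrightarrow> f \<odot> X \<in> V"
  unfolding vfields_def by (auto simp: vscale_def fun_eq_iff algebra_simps smooth_mult)

lemma vf_uminus_closed: "X \<in> V \<Longrightarrow> - X \<in> V"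
  unfolding vfields_def by (auto simp: fun_eq_iff algebra_simps smooth_uminus)

lemma vf_diff_closed: "X \<in> V \<Longrightarrow> Y \<in> V \<Longrightarrow> X - Y \<in> V"
  using vf_plus_closed[of X "- Y"] vf_uminus_closed by simp

lemma vf_zero: "0 \<in> V"
  unfolding vfields_def by (auto simp: fun_eq_iff smooth_zero)

lemma bracket_closed:
  assumes X: "X \<in> V" and Y: "Y \<in> V"
  shows "lie_bracket X Y \<in> V"
proof -
  note smooth = vf_smooth[OF X] vf_smooth[OF Y]
  have "lie_bracket X Y f \<in> C" if "f \<in> C" for f
    using that by (simp add: lie_bracket_def smooth smooth_diff)
  moreover have "lie_bracket X Y (f + h) = lie_bracket X Y f + lie_bracket X Y h"
    if "f \<in> C" "h \<in> C" for f h
    using that by (simp add: lie_bracket_def smooth vf_add[OF X] vf_add[OF Y])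
  moreover have "lie_bracket X Y (\<lambda>p. c * f p) = (\<lambda>p. c * lie_bracket X Y f p)"
    if "f \<in> C" for f c
    using that
    by (simp add: lie_bracket_def smooth vf_cmult[OF X] vf_cmult[OF Y] fun_eq_iff right_diff_distrib)
  moreover have "lie_bracket X Y (f * h) = lie_bracket X Y f * h + f * lie_bracket X Y h"
    if "f \<in> C" "h \<in> C" for f h
    using that
    by (simp add: lie_bracket_def smooth smooth_mult vf_mult[OF X] vf_mult[OF Y]
        vf_add[OF X] vf_add[OF Y] algebra_simps)
  moreover have "lie_bracket X Y f = 0" if "f \<notin> C" for f
    using vf_off_smooth[OF X that] vf_off_smooth[OF Y that]
      vf_const[OF X, of 0] vf_const[OF Y, of 0]
    by (simp add: lie_bracket_def zero_fun_def)
  ultimately show ?thesis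
    unfolding vfields_def by blast
qed

lemma vf_eqI:
  assumes "X \<in> V" "Y \<in> V" "\<And>f. f \<in> C \<Longrightarrow> X f = Y f"
  shows "X = Y"
  using assms vf_off_smooth by (metis ext)

lemma bracket_scale_left:
  assumes X: "X \<in> V" and Y: "Y \<in> V" and f: "f \<in> C"
  shows "lie_bracket (f \<odot> X) Y = f \<odot> lie_bracket X Y - Y f \<odot> X"
proof (rule vf_eqI)
  show "lie_bracket (f \<odot> X) Y h = (f \<odot> lie_bracket X Y - Y f \<odot> X) h" if "h \<in> C" for h
    using that vf_mult[OF Y f vf_smooth[OF X that]]
    by (simp add: lie_bracket_def vscale_def fun_eq_iff algebra_simps)
qed (rule bracket_closed[OF vf_scale_closed[OF f X] Y],
    rule vf_diff_closed[OF vf_scale_closed[OF f bracket_closed[OF X Y]]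
      vf_scale_closed[OF vf_smooth[OF Y f] X]])

end


section \<open>Additive maps, brackets and connections\<close>

context smooth_manifold
begin

lemma additive_zero:
  fixes F :: "'a vfield \<Rightarrow> 'b::ab_group_add"
  assumes "\<And>X Y. X \<in> V \<Longrightarrow> Y \<in> V \<Longrightarrow> F (X + Y) = F X + F Y"
  shows "F 0 = 0"
  using assms[OF vf_zero vf_zero] by simp

lemma additive_uminus:
  fixes F :: "'a vfield \<Rightarrow> 'b::ab_group_add"
  assumes "\<And>X Y. X \<in> V \<Longrightarrow> Y \<in> V \<Longrightarrow> F (X + Y) = F X + F Y" and "X \<in> V"
  shows "F (- X) = - F X"
  using assms(1)[OF assms(2) vf_uminus_closed[OF assms(2)]] additive_zero[of F, OF assms(1)]
  by (simp add: eq_neg_iff_add_eq_0 add.commute)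

lemma additive_diff:
  fixes F :: "'a vfield \<Rightarrow> 'b::ab_group_add"
  assumes "\<And>X Y. X \<in> V \<Longrightarrow> Y \<in> V \<Longrightarrow> F (X + Y) = F X + F Y" and "X \<in> V" "Y \<in> V"
  shows "F (X - Y) = F X - F Y"
  using assms(1)[OF assms(2) vf_uminus_closed[OF assms(3)]] additive_uminus[of F, OF assms(1,3)]
  by simp

lemma bracket_uminus_right:
  assumes X: "X \<in> V" and Y: "Y \<in> V"
  shows "lie_bracket X (- Y) = - lie_bracket X Y"
proof (rule vf_eqI)
  show "lie_bracket X (- Y) f = (- lie_bracket X Y) f" if "f \<in> C" for f
    using vf_uminus[OF X vf_smooth[OF Y that]] by (simp add: lie_bracket_def)
qed (intro bracket_closed vf_uminus_closed X Y)+

lemma bracket_skew: "lie_bracket X Y = - lie_bracket Y X"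
  by (simp add: lie_bracket_def fun_eq_iff)

lemma
  assumes "affine_connection A D" and "X \<in> V" and "Y \<in> V"
  shows connection_closed: "D X Y \<in> V"
    and connection_add_left: "Z \<in> V \<Longrightarrow> D (X + Y) Z = D X Z + D Y Z"
    and connection_add_right: "Z \<in> V \<Longrightarrow> D X (Y + Z) = D X Y + D X Z"
    and connection_scale_left: "f \<in> C \<Longrightarrow> D (f \<odot> X) Y = f \<odot> D X Y"
    and connection_scale_right: "f \<in> C \<Longrightarrow> D X (f \<odot> Y) = X f \<odot> Y + f \<odot> D X Y"
  using assms by (simp_all add: affine_connection_def)

lemma connection_uminus_right:
  assumes "affine_connection A D" and "X \<in> V" and "Y \<in> V"
  shows "D X (- Y) = - D X Y"
  using additive_uminus[of "D X" Y] connection_add_right[OF assms(1,2)] assms(3) by simp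

lemma torsion_closed:
  assumes "affine_connection A D" and "X \<in> V" and "Y \<in> V"
  shows "torsion D X Y \<in> V"
  unfolding torsion_def
  by (intro vf_diff_closed bracket_closed connection_closed[OF assms(1)] assms(2,3))

lemma connection_uminus_left:
  assumes "affine_connection A D" and "X \<in> V" and "Y \<in> V"
  shows "D (- X) Y = - D X Y"
  using additive_uminus[of "\<lambda>X. D X Y" X] connection_add_left[OF assms(1)] assms(2,3) by simp

lemma torsion_uminus_right:
  assumes "affine_connection A D" and "X \<in> V" and "Y \<in> V"
  shows "torsion D X (- Y) = - torsion D X Y"
  using assms(2,3)
  by (simp add: torsion_def bracket_uminus_right connection_uminus_left[OF assms(1)]
      connection_uminus_right[OF assms(1)])

end


section \<open>Almost contact structures with a B-metric\<close>

text \<open>The algebraic part of an almost contact B-metric structure, without dimension and signature. It passes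
  to the conformal image of the structure, so that each lemma about it applies to both structures.\<close>

locale contact_B_structure = smooth_manifold A
  for A :: "('a::{t2_space, second_countable_topology}, 'e::euclidean_space) atlas" +
  fixes \<phi> :: "'a endo" and \<xi> :: "'a vfield" and \<eta> :: "'a one_form" and g :: "'a bilin"
  assumes endo: "is_endo A \<phi>"
    and xi_closed: "\<xi> \<in> V"
    and eta_form: "is_one_form A \<eta>"
    and metric_form: "Y \<in> V \<Longrightarrow> is_one_form A (\<lambda>X. g X Y)"
    and metric_sym: "X \<in> V \<Longrightarrow> Y \<in> V \<Longrightarrow> g X Y = g Y X"
    and metric_nondegenerate: "X \<in> V \<Longrightarrow> (\<And>Y. Y \<in> V \<Longrightarrow> g X Y p = 0) \<Longrightarrow> f \<in> C \<Longrightarrow> X f p = 0"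
    and phi_xi: "\<phi> \<xi> = 0"
    and phi_phi: "X \<in> V \<Longrightarrow> \<phi> (\<phi> X) = - X + \<eta> X \<odot> \<xi>"
    and eta_phi: "X \<in> V \<Longrightarrow> \<eta> (\<phi> X) = 0"
    and eta_xi: "\<eta> \<xi> = 1"
    and metric_phi_phi: "X \<in> V \<Longrightarrow> Y \<in> V \<Longrightarrow> g (\<phi> X) (\<phi> Y) = - g X Y + \<eta> X * \<eta> Y"
begin

lemma phi_closed: "X \<in> V \<Longrightarrow> \<phi> X \<in> V"
  and phi_add: "X \<in> V \<Longrightarrow> Y \<in> V \<Longrightarrow> \<phi> (X + Y) = \<phi> X + \<phi> Y"
  and phi_scale: "f \<in> C \<Longrightarrow> X \<in> V \<Longrightarrow> \<phi> (f \<odot> X) = f \<odot> \<phi> X"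
  using endo by (auto simp: is_endo_def)

lemma phi_zero: "\<phi> 0 = 0"
  using additive_zero[of \<phi>] phi_add by simp

lemma phi_diff: "X \<in> V \<Longrightarrow> Y \<in> V \<Longrightarrow> \<phi> (X - Y) = \<phi> X - \<phi> Y"
  using additive_diff[of \<phi>] phi_add by simp

lemma eta_smooth: "X \<in> V \<Longrightarrow> \<eta> X \<in> C"
  and eta_add: "X \<in> V \<Longrightarrow> Y \<in> V \<Longrightarrow> \<eta> (X + Y) = \<eta> X + \<eta> Y"
  and eta_scale: "f \<in> C \<Longrightarrow> X \<in> V \<Longrightarrow> \<eta> (f \<odot> X) = f * \<eta> X"
  using eta_form by (auto simp: is_one_form_def)

lemma eta_uminus: "X \<in> V \<Longrightarrow> \<eta> (- X) = - \<eta> X"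
  using additive_uminus[of \<eta>] eta_add by simp

lemma eta_diff: "X \<in> V \<Longrightarrow> Y \<in> V \<Longrightarrow> \<eta> (X - Y) = \<eta> X - \<eta> Y"
  using additive_diff[of \<eta>] eta_add by simp

lemma metric_smooth: "X \<in> V \<Longrightarrow> Y \<in> V \<Longrightarrow> g X Y \<in> C"
  and metric_add_left: "X \<in> V \<Longrightarrow> Y \<in> V \<Longrightarrow> Z \<in> V \<Longrightarrow> g (X + Y) Z = g X Z + g Y Z"
  and metric_scale_left: "f \<in> C \<Longrightarrow> X \<in> V \<Longrightarrow> Y \<in> V \<Longrightarrow> g (f \<odot> X) Y = f * g X Y"
  using metric_form by (auto simp: is_one_form_def)

lemma metric_uminus_left: "X \<in> V \<Longrightarrow> Y \<in> V \<Longrightarrow> g (- X) Y = - g X Y"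
  using additive_uminus[of "\<lambda>X. g X Y"] metric_add_left by simp

lemma metric_diff_left: "X \<in> V \<Longrightarrow> Y \<in> V \<Longrightarrow> Z \<in> V \<Longrightarrow> g (X - Y) Z = g X Z - g Y Z"
  using additive_diff[of "\<lambda>X. g X Z"] metric_add_left by simp

lemma metric_add_right: "X \<in> V \<Longrightarrow> Y \<in> V \<Longrightarrow> Z \<in> V \<Longrightarrow> g X (Y + Z) = g X Y + g X Z"
  using metric_sym[of "Y + Z" X] metric_sym[of Y X] metric_sym[of Z X] metric_add_left[of Y Z X]
  by (simp add: vf_plus_closed)

lemma metric_scale_right: "f \<in> C \<Longrightarrow> X \<in> V \<Longrightarrow> Y \<in> V \<Longrightarrow> g X (f \<odot> Y) = f * g X Y"
  using metric_sym[of "f \<odot> Y" X] metric_sym[of Y X] metric_scale_left[of f Y X]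
  by (simp add: vf_scale_closed)

lemma metric_uminus_right: "X \<in> V \<Longrightarrow> Y \<in> V \<Longrightarrow> g X (- Y) = - g X Y"
  using additive_uminus[of "g X"] metric_add_right by simp

lemma metric_diff_right: "X \<in> V \<Longrightarrow> Y \<in> V \<Longrightarrow> Z \<in> V \<Longrightarrow> g X (Y - Z) = g X Y - g X Z"
  using additive_diff[of "g X"] metric_add_right by simp

lemma metric_zero_right: "X \<in> V \<Longrightarrow> g X 0 = 0"
  using additive_zero[of "g X"] metric_add_right by simp

lemma metric_xi_right: "X \<in> V \<Longrightarrow> g X \<xi> = \<eta> X"
  using metric_phi_phi[of X \<xi>]
  by (simp add: xi_closed phi_xi eta_xi metric_zero_right phi_closed)

lemma metric_xi_left: "X \<in> V \<Longrightarrow> g \<xi> X = \<eta> X"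
  by (simp add: metric_sym[OF xi_closed] metric_xi_right)

text \<open>Together with \<open>\<phi>\<^sup>2 = - 1\<close> on horizontal fields, the symmetry of \<open>\<phi>\<close> makes
  \<open>g X Y - \<i> g X (\<phi> Y)\<close> complex bilinear there, with \<open>\<phi>\<close> acting as the imaginary unit.\<close>

lemma metric_phi_left:
  assumes "X \<in> V" "Y \<in> V"
  shows "g (\<phi> X) Y = g X (\<phi> Y)"
proof -
  have "g (\<phi> X) (\<phi> (\<phi> Y)) = - g (\<phi> X) Y"
    using assms
    by (simp add: phi_phi metric_diff_right metric_scale_right phi_closed vf_scale_closed
        xi_closed eta_smooth metric_xi_right eta_phi)
  then show ?thesis
    using metric_phi_phi[of X "\<phi> Y"] assms by (simp add: phi_closed eta_phi)
qed

lemma metric_eqI: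
  assumes "X \<in> V" "Y \<in> V" "\<And>Z p. Z \<in> V \<Longrightarrow> g X Z p = g Y Z p"
  shows "X = Y"
proof (rule vf_eqI[OF assms(1,2)])
  fix f assume "f \<in> C"
  then have "(X - Y) f p = 0" for p
    using assms
    by (intro metric_nondegenerate[of "X - Y"]) (auto simp: vf_diff_closed metric_diff_left)
  then show "X f = Y f"
    by (simp add: fun_eq_iff)
qed

text \<open>The horizontal fields, on which \<open>\<phi>\<close> is a complex structure.\<close>

definition H :: "'a vfield set" where
  "H = {X \<in> V. \<eta> X = 0}"

lemma H_closed: "X \<in> H \<Longrightarrow> X \<in> V"
  and eta_H: "X \<in> H \<Longrightarrow> \<eta> X = 0"
  by (auto simp: H_def)

lemma phi_H: "X \<in> V \<Longrightarrow> \<phi> X \<in> H"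
  by (simp add: H_def phi_closed eta_phi)

lemma phi_phi_H: "X \<in> H \<Longrightarrow> \<phi> (\<phi> X) = - X"
  by (simp add: H_def phi_phi) (simp add: vscale_def fun_eq_iff)

lemma metric_phi_phi_H: "X \<in> H \<Longrightarrow> Y \<in> V \<Longrightarrow> g (\<phi> X) (\<phi> Y) = - g X Y"
  by (simp add: H_def metric_phi_phi)

lemma decompose:
  assumes "X \<in> V"
  shows "X = - \<phi> (\<phi> X) + \<eta> X \<odot> \<xi>" "- \<phi> (\<phi> X) \<in> H"
  using assms
  by (simp_all add: phi_phi H_def vf_diff_closed vf_scale_closed eta_smooth xi_closed
      eta_diff eta_scale eta_xi)

lemma eq_by_horizontal:
  assumes X: "X \<in> V" and Y: "Y \<in> V" and "\<eta> X = \<eta> Y"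
    and "\<And>Z p. Z \<in> H \<Longrightarrow> g X Z p = g Y Z p"
  shows "X = Y"
proof (rule metric_eqI[OF X Y])
  fix Z p assume Z: "Z \<in> V"
  have "g W Z p = g W (- \<phi> (\<phi> Z)) p + \<eta> Z p * \<eta> W p" if "W \<in> V" for W
  proof -
    have "g W Z = g W (- \<phi> (\<phi> Z) + \<eta> Z \<odot> \<xi>)"
      using decompose(1)[OF Z] by simp
    also have "\<dots> = g W (- \<phi> (\<phi> Z)) + \<eta> Z * \<eta> W"
      using metric_add_right[OF that H_closed[OF decompose(2)[OF Z]]] Z that
      by (simp only: vf_scale_closed eta_smooth xi_closed metric_scale_right metric_xi_right)
    finally show ?thesis by simp
  qed
  then show "g X Z p = g Y Z p"
    using X Y assms(3,4) decompose(2)[OF Z] by simp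
qed

text \<open>Otherwise \<open>g\<close> would equal \<open>\<eta> \<otimes> \<eta>\<close> at \<open>p\<close>, which has rank one and
  admits no pair of orthogonal non-null vectors.\<close>

lemma metric_nonzero_on_horizontal:
  assumes X: "X \<in> V" and Y: "Y \<in> V"
    and "g X Y p = 0" and "g X X p \<noteq> 0" and "g Y Y p \<noteq> 0"
  shows "\<exists>y\<in>H. \<exists>z\<in>H. g y z p \<noteq> 0"
proof (rule ccontr)
  assume "\<not> (\<exists>y\<in>H. \<exists>z\<in>H. g y z p \<noteq> 0)"
  then have "g (\<phi> Z) (\<phi> W) p = 0" if "Z \<in> V" "W \<in> V" for Z W
    using phi_H that by blast
  then have "g Z W p = \<eta> Z p * \<eta> W p" if "Z \<in> V" "W \<in> V" for Z W
    using fun_cong[OF metric_phi_phi[OF that], of p] that by simp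
  then show False
    using assms by auto
qed

end


section \<open>Natural and canonical connections\<close>

context contact_B_structure
begin

lemma
  assumes D: "natural_connection A \<phi> \<xi> \<eta> g D"
  shows natural_affine: "affine_connection A D"
    and natural_phi: "X \<in> V \<Longrightarrow> Y \<in> V \<Longrightarrow> D X (\<phi> Y) = \<phi> (D X Y)"
    and natural_xi: "X \<in> V \<Longrightarrow> D X \<xi> = 0"
    and natural_eta: "X \<in> V \<Longrightarrow> Y \<in> V \<Longrightarrow> X (\<eta> Y) = \<eta> (D X Y)"
    and natural_metric: "X \<in> V \<Longrightarrow> Y \<in> V \<Longrightarrow> Z \<in> V \<Longrightarrow> X (g Y Z) = g (D X Y) Z + g Y (D X Z)"
  using D unfolding natural_connection_def cov_endo_def cov_form_def cov_bilin_def
  by (simp_all add: diff_eq_eq add.commute plus_fun_def)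

lemma natural_H:
  assumes D: "natural_connection A \<phi> \<xi> \<eta> g D" and X: "X \<in> V" and Y: "Y \<in> H"
  shows "D X Y \<in> H"
  using natural_eta[OF D X H_closed[OF Y]] eta_H[OF Y] vf_const[OF X, of 0]
    connection_closed[OF natural_affine[OF D] X H_closed[OF Y]]
  by (simp add: H_def zero_fun_def)

text \<open>On horizontal fields, up to a factor of two and modulo \<open>\<xi>\<close>, the \<open>\<phi>\<close>-linear part of the Lie
  derivative along \<open>\<xi>\<close>.\<close>

definition phi_linear_lie :: "'a vfield \<Rightarrow> 'a vfield" where
  "phi_linear_lie Y = lie_bracket \<xi> Y - \<phi> (lie_bracket \<xi> (\<phi> Y))"

lemma levi_civita_facts:
  assumes L: "levi_civita A g L"
  shows levi_civita_affine: "affine_connection A L"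
    and levi_civita_torsion: "X \<in> V \<Longrightarrow> Y \<in> V \<Longrightarrow> L X Y = L Y X + lie_bracket X Y"
    and levi_civita_metric: "X \<in> V \<Longrightarrow> Y \<in> V \<Longrightarrow> Z \<in> V \<Longrightarrow> X (g Y Z) = g (L X Y) Z + g Y (L X Z)"
proof -
  show "affine_connection A L"
    using L by (simp add: levi_civita_def)
  show "L X Y = L Y X + lie_bracket X Y" if "X \<in> V" "Y \<in> V"
  proof -
    have "torsion L X Y = 0"
      using L that by (simp add: levi_civita_def)
    then show ?thesis
      by (simp add: torsion_def algebra_simps)
  qed
  show "X (g Y Z) = g (L X Y) Z + g Y (L X Z)" if "X \<in> V" "Y \<in> V" "Z \<in> V"
  proof -
    have "cov_bilin L g X Y Z = 0"
      using L that by (simp add: levi_civita_def)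
    then show ?thesis
      by (simp add: cov_bilin_def algebra_simps)
  qed
qed

text \<open>The second identity is \<open>L \<xi> y = L y \<xi> + [\<xi>, y]\<close> together with the fact that the
  form \<open>g (L y \<xi>) z\<close>, skew-symmetrised in \<open>y\<close> and \<open>z\<close>, is the exterior derivative of \<open>\<eta>\<close>. The two
  identities express \<open>g (L \<xi> y) z\<close> through derivatives along \<open>\<xi>\<close> and Lie brackets.\<close>

lemma levi_civita_xi:
  assumes L: "levi_civita A g L" and y: "y \<in> H" and z: "z \<in> H"
  shows "g (L \<xi> y) z p + g (L \<xi> z) y p = \<xi> (g y z) p" (is ?metric)
    and "g (L \<xi> y) z p - g (L \<xi> z) y p
      = g (lie_bracket \<xi> y) z p - g (lie_bracket \<xi> z) y p - \<eta> (lie_bracket y z) p" (is ?skew)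
proof -
  note affine = levi_civita_affine[OF L]
  note V = H_closed[OF y] H_closed[OF z] xi_closed
  note LV = connection_closed[OF affine V(1,2)] connection_closed[OF affine V(2,1)]
    connection_closed[OF affine V(3,1)] connection_closed[OF affine V(3,2)]
    connection_closed[OF affine V(1,3)] connection_closed[OF affine V(2,3)]
  note BV = bracket_closed[OF V(1,2)] bracket_closed[OF V(3,1)] bracket_closed[OF V(3,2)]
  show ?metric
    using levi_civita_metric[OF L V(3,1,2)] metric_sym[OF V(1) LV(4)] by simp
  have "g (L y \<xi>) z + \<eta> (L y z) = 0"
    using levi_civita_metric[OF L V(1,3,2)] metric_xi_left[OF V(2)] metric_xi_left[OF LV(1)]
      eta_H[OF z] vf_const[OF V(1), of 0]
    by (simp add: zero_fun_def)
  moreover have "g (L z \<xi>) y + \<eta> (L z y) = 0"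
    using levi_civita_metric[OF L V(2,3,1)] metric_xi_left[OF V(1)] metric_xi_left[OF LV(2)]
      eta_H[OF y] vf_const[OF V(2), of 0]
    by (simp add: zero_fun_def)
  moreover have "g (L \<xi> y) z = g (L y \<xi>) z + g (lie_bracket \<xi> y) z"
    using levi_civita_torsion[OF L V(3,1)] metric_add_left[OF LV(5) BV(2) V(2)] by simp
  moreover have "g (L \<xi> z) y = g (L z \<xi>) y + g (lie_bracket \<xi> z) y"
    using levi_civita_torsion[OF L V(3,2)] metric_add_left[OF LV(6) BV(3) V(1)] by simp
  moreover have "\<eta> (L y z) = \<eta> (L z y) + \<eta> (lie_bracket y z)"
    using levi_civita_torsion[OF L V(1,2)] eta_add[OF LV(2) BV(1)] by simp
  ultimately show ?skew
    by (simp add: fun_eq_iff) (smt (verit))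
qed

lemma nijenhuis_closed:
  assumes L: "affine_connection A L" and X: "X \<in> V" and Y: "Y \<in> V"
  shows "nijenhuis_phi \<phi> X Y \<in> V" and "d_form L \<eta> X Y \<in> C"
    and "nijenhuis_tensor L \<phi> \<xi> \<eta> X Y \<in> V"
proof -
  show phi: "nijenhuis_phi \<phi> X Y \<in> V"
    unfolding nijenhuis_phi_def
    by (intro vf_plus_closed vf_diff_closed phi_closed bracket_closed X Y)
  show form: "d_form L \<eta> X Y \<in> C"
    unfolding d_form_def cov_form_def
    by (intro smooth_diff eta_smooth connection_closed[OF L] vf_smooth[OF X] vf_smooth[OF Y] X Y)
  show "nijenhuis_tensor L \<phi> \<xi> \<eta> X Y \<in> V"
    unfolding nijenhuis_tensor_def by (intro vf_plus_closed vf_scale_closed phi form xi_closed)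
qed

text \<open>In the explicit formula the derivative \<open>D \<xi> y\<close> is the \<open>\<phi>\<close>-linear part of \<open>L \<xi> y\<close>, corrected by a
  Nijenhuis term. That term cancels the contribution of \<open>d\<eta>\<close> to the Levi-Civita connection, and what
  is left involves derivatives along \<open>\<xi>\<close> and Lie brackets with \<open>\<xi>\<close>, but no connection.\<close>

lemma canonical_xi:
  assumes L: "levi_civita A g L" and D: "natural_connection A \<phi> \<xi> \<eta> g D"
    and formula: "phi_canonical_formula A \<phi> \<xi> \<eta> g L D"
    and y: "y \<in> H" and z: "z \<in> H"
  shows "g (D \<xi> y) z p = 1 / 2 * \<xi> (g y z) p
    + 1 / 4 * (g (phi_linear_lie y) z p - g y (phi_linear_lie z) p)"
proof -
  note affine = levi_civita_affine[OF L]
  note V = H_closed[OF y] H_closed[OF z] xi_closed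
  note pH = phi_H[OF V(1)] phi_H[OF V(2)]
  note pV = H_closed[OF pH(1)] H_closed[OF pH(2)]
  note LV = connection_closed[OF affine V(3,1)] connection_closed[OF affine V(3) pV(1)]
  note BV = bracket_closed[OF V(3,1)] bracket_closed[OF V(3,2)]
    bracket_closed[OF V(3) pV(1)] bracket_closed[OF V(3) pV(2)]
  \<comment> \<open>The Levi-Civita term: \<open>F\<close> turns \<open>L \<xi>\<close> into its part commuting with \<open>\<phi>\<close>.\<close>
  have F: "fundamental_tensor L \<phi> g \<xi> (\<phi> y) z p = - g (L \<xi> y) z p - g (L \<xi> (\<phi> y)) (\<phi> z) p"
    unfolding fundamental_tensor_def cov_endo_def
    by (simp add: phi_phi_H[OF y] connection_uminus_right[OF affine V(3,1)] metric_diff_left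
        vf_uminus_closed LV phi_closed V metric_uminus_left metric_phi_left)
  have d_eta: "d_form L \<eta> (\<phi> z) (\<phi> y) = - \<eta> (lie_bracket (\<phi> z) (\<phi> y))"
  proof -
    have "\<eta> (L (\<phi> z) (\<phi> y)) = \<eta> (L (\<phi> y) (\<phi> z)) + \<eta> (lie_bracket (\<phi> z) (\<phi> y))"
      unfolding levi_civita_torsion[OF L pV(2,1)]
      by (rule eta_add[OF connection_closed[OF affine pV] bracket_closed[OF pV(2,1)]])
    then show ?thesis
      using vf_const[OF pV(1), of 0] vf_const[OF pV(2), of 0]
      by (simp add: d_form_def cov_form_def eta_H[OF pH(1)] eta_H[OF pH(2)] zero_fun_def)
  qed
  have brackets: "lie_bracket (- z) (- y) = lie_bracket z y"
    using bracket_uminus_right[OF vf_uminus_closed[OF V(2)] V(1)] bracket_skew[of "- z" y]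
      bracket_uminus_right[OF V(1,2)] bracket_skew[of y z]
    by simp
  note NV = bracket_closed[OF V(2,1)] bracket_closed[OF pV(2,1)]
    bracket_closed[OF vf_uminus_closed[OF V(2)] pV(1)]
    bracket_closed[OF pV(2) vf_uminus_closed[OF V(1)]]
  have "\<eta> (nijenhuis_phi \<phi> (\<phi> z) (\<phi> y)) = \<eta> (lie_bracket z y)"
    unfolding nijenhuis_phi_def phi_phi_H[OF y] phi_phi_H[OF z] brackets
    by (simp add: eta_diff eta_add eta_phi vf_plus_closed vf_diff_closed phi_closed NV)
  then have N: "g (nijenhuis_tensor L \<phi> \<xi> \<eta> (\<phi> z) (\<phi> y)) \<xi>
      = \<eta> (lie_bracket z y) - \<eta> (lie_bracket (\<phi> z) (\<phi> y))"
    unfolding nijenhuis_tensor_def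
    using nijenhuis_closed[OF affine pV(2,1)]
    by (simp add: metric_xi_right vf_plus_closed vf_scale_closed V eta_add eta_scale d_eta eta_xi)
  have skew: "\<eta> (lie_bracket z y) = - \<eta> (lie_bracket y z)"
      "\<eta> (lie_bracket (\<phi> z) (\<phi> y)) = - \<eta> (lie_bracket (\<phi> y) (\<phi> z))"
    using bracket_skew[of z y] bracket_skew[of "\<phi> z" "\<phi> y"]
      eta_uminus[OF bracket_closed[OF V(1,2)]] eta_uminus[OF bracket_closed[OF pV]]
    by simp_all
  have zero: "\<phi> (\<phi> \<xi>) = 0" "\<eta> y = 0" "\<eta> z = 0"
    using y z by (simp_all add: phi_xi phi_zero eta_H)
  have zero': "g (nijenhuis_tensor L \<phi> \<xi> \<eta> (\<phi> (\<phi> z)) (\<phi> (\<phi> y))) 0 = 0"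
    by (rule metric_zero_right[OF nijenhuis_closed(3)[OF affine phi_closed[OF pV(2)]
            phi_closed[OF pV(1)]]])
  have D_eq: "g (D \<xi> y) z p - g (L \<xi> y) z p
      = 1 / 2 * (- g (L \<xi> y) z p - g (L \<xi> (\<phi> y)) (\<phi> z) p)
      - 1 / 4 * (- \<eta> (lie_bracket y z) p + \<eta> (lie_bracket (\<phi> y) (\<phi> z)) p)"
    using formula[unfolded phi_canonical_formula_def Let_def, rule_format, OF V(3,1,2), of p]
    unfolding zero zero' F N skew eta_xi
    using metric_diff_left[OF connection_closed[OF natural_affine[OF D] V(3,1)] LV(1) V(2)]
    by simp
  have op: "g (phi_linear_lie y) z p = g (lie_bracket \<xi> y) z p - g (lie_bracket \<xi> (\<phi> y)) (\<phi> z) p"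
      "g y (phi_linear_lie z) p = g (lie_bracket \<xi> z) y p - g (lie_bracket \<xi> (\<phi> z)) (\<phi> y) p"
    unfolding phi_linear_lie_def
    by (simp_all add: metric_sym[OF V(1)] metric_diff_left phi_closed BV V vf_diff_closed
        metric_phi_left)
  have "\<xi> (g (\<phi> y) (\<phi> z)) p = - \<xi> (g y z) p"
    using metric_phi_phi_H[OF y V(2)] vf_uminus[OF V(3) metric_smooth[OF V(1,2)]] by simp
  (* The terms with eta in D_eq and in the Levi-Civita identities cancel. *)
  then show ?thesis
    using D_eq op levi_civita_xi[OF L y z, of p] levi_civita_xi[OF L pH, of p] by argo
qed

lemma canonical_torsion_H:
  assumes "phi_canonical_torsion A \<phi> \<xi> \<eta> g D" and H: "x \<in> H" "y \<in> H" "z \<in> H"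
  shows "g (torsion D x y) z p - g (torsion D x (\<phi> y)) (\<phi> z) p
    - g (torsion D x z) y p + g (torsion D x (\<phi> z)) (\<phi> y) p = 0"
  using fun_cong[OF assms(1)[unfolded phi_canonical_torsion_def Let_def, rule_format,
        OF H_closed[OF H(1)] H_closed[OF H(2)] H_closed[OF H(3)]], of p]
  by (simp add: eta_H H)

lemma phi_linear_lie_closed: "Y \<in> V \<Longrightarrow> phi_linear_lie Y \<in> V"
  unfolding phi_linear_lie_def by (intro vf_diff_closed phi_closed bracket_closed xi_closed)

text \<open>The operator commutes with \<open>\<phi>\<close> up to multiples of \<open>\<xi>\<close>, which are orthogonal to horizontal
  fields.\<close>

lemma metric_phi_linear_lie:
  assumes y: "y \<in> H" and z: "z \<in> H"
  shows "g y (\<phi> (phi_linear_lie z)) = g y (phi_linear_lie (\<phi> z))"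
proof -
  note V = H_closed[OF y] H_closed[OF z]
  note B = bracket_closed[OF xi_closed V(2)] bracket_closed[OF xi_closed phi_closed[OF V(2)]]
  have "\<phi> (phi_linear_lie z) = \<phi> (lie_bracket \<xi> z) - (- lie_bracket \<xi> (\<phi> z)
      + \<eta> (lie_bracket \<xi> (\<phi> z)) \<odot> \<xi>)"
    unfolding phi_linear_lie_def by (simp add: phi_diff phi_closed B phi_phi)
  moreover have "phi_linear_lie (\<phi> z) = lie_bracket \<xi> (\<phi> z) + \<phi> (lie_bracket \<xi> z)"
    unfolding phi_linear_lie_def phi_phi_H[OF z] bracket_uminus_right[OF xi_closed V(2)]
    using phi_diff[OF vf_zero B(1)] by (simp add: phi_zero)
  ultimately have "\<phi> (phi_linear_lie z) = phi_linear_lie (\<phi> z) - \<eta> (lie_bracket \<xi> (\<phi> z)) \<odot> \<xi>"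
    by simp
  then show ?thesis
    by (simp add: metric_diff_right V phi_linear_lie_closed phi_closed vf_scale_closed eta_smooth B
        xi_closed metric_scale_right metric_xi_right eta_H[OF y])
qed

end


section \<open>The conformal change of the structure\<close>

locale conformal_change = contact_B_structure A \<phi> \<xi> \<eta> g
  for A :: "('a::{t2_space, second_countable_topology}, 'e::euclidean_space) atlas"
    and \<phi> \<xi> \<eta> g +
  fixes u v w :: "'a \<Rightarrow> real"
  assumes smooth: "u \<in> C" "v \<in> C" "w \<in> C"
begin

abbreviation \<xi>' where "\<xi>' \<equiv> conf_xi w \<xi>"
abbreviation \<eta>' where "\<eta>' \<equiv> conf_eta w \<eta>"
abbreviation g' where "g' \<equiv> conf_metric u v w \<phi> \<eta> g"

definition \<alpha> where "\<alpha> = (\<lambda>p. exp (2 * u p) * cos (2 * v p))"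
definition \<beta> where "\<beta> = (\<lambda>p. exp (2 * u p) * sin (2 * v p))"
definition \<gamma> where "\<gamma> = (\<lambda>p. exp (2 * w p))"

lemma conf_metric_eq: "g' X Y = \<alpha> * g X Y + \<beta> * g X (\<phi> Y) + (\<gamma> - \<alpha>) * \<eta> X * \<eta> Y"
  by (simp add: conf_metric_def Let_def \<alpha>_def \<beta>_def \<gamma>_def)

lemma smooth_factors: "\<alpha> \<in> C" "\<beta> \<in> C" "\<gamma> \<in> C"
    "(\<lambda>p. exp (w p)) \<in> C" "(\<lambda>p. exp (- w p)) \<in> C"
proof -
  note parts = smooth_exp[OF smooth_cmult[OF smooth(1), of 2]]
    smooth_cos[OF smooth_cmult[OF smooth(2), of 2]] smooth_sin[OF smooth_cmult[OF smooth(2), of 2]]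
  show "\<alpha> \<in> C" "\<beta> \<in> C"
    using smooth_mult[OF parts(1,2)] smooth_mult[OF parts(1,3)]
    by (simp_all add: \<alpha>_def \<beta>_def times_fun_def)
  show "\<gamma> \<in> C"
    unfolding \<gamma>_def by (rule smooth_exp[OF smooth_cmult[OF smooth(3)]])
  show "(\<lambda>p. exp (w p)) \<in> C"
    by (rule smooth_exp[OF smooth(3)])
  show "(\<lambda>p. exp (- w p)) \<in> C"
    using smooth_exp[OF smooth_uminus[OF smooth(3)]] by simp
qed

text \<open>The first two are the real and the imaginary part of the derivative of \<open>exp (2 (u + \<i> v))\<close>.\<close>

lemma vf_factors:
  assumes X: "X \<in> V"
  shows "X \<alpha> p = 2 * (\<alpha> p * X u p - \<beta> p * X v p)"
    and "X \<beta> p = 2 * (\<beta> p * X u p + \<alpha> p * X v p)"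
    and "X (\<lambda>q. exp (w q)) p = exp (w p) * X w p"
    and "X (\<lambda>q. exp (- w q)) p = - exp (- w p) * X w p"
proof -
  note two = smooth_cmult[OF smooth(1), of 2] smooth_cmult[OF smooth(2), of 2]
  note parts = smooth_exp[OF two(1)] smooth_cos[OF two(2)] smooth_sin[OF two(2)]
  have eqs: "\<alpha> = (\<lambda>p. exp (2 * u p)) * (\<lambda>p. cos (2 * v p))"
      "\<beta> = (\<lambda>p. exp (2 * u p)) * (\<lambda>p. sin (2 * v p))"
    by (simp_all add: \<alpha>_def \<beta>_def times_fun_def)
  note X2 = vf_cmult[OF X smooth(1), of 2] vf_cmult[OF X smooth(2), of 2]
  show "X \<alpha> p = 2 * (\<alpha> p * X u p - \<beta> p * X v p)"
    unfolding eqs vf_mult[OF X parts(1,2)] vf_exp[OF X two(1)] vf_cos[OF X two(2)] X2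
    by (simp add: algebra_simps)
  show "X \<beta> p = 2 * (\<beta> p * X u p + \<alpha> p * X v p)"
    unfolding eqs vf_mult[OF X parts(1,3)] vf_exp[OF X two(1)] vf_sin[OF X two(2)] X2
    by (simp add: algebra_simps)
  show "X (\<lambda>q. exp (w q)) p = exp (w p) * X w p"
    using vf_exp[OF X smooth(3)] by simp
  show "X (\<lambda>q. exp (- w q)) p = - exp (- w p) * X w p"
    using vf_exp[OF X smooth_uminus[OF smooth(3)]] vf_uminus[OF X smooth(3)] by simp
qed

lemma factors_nonzero: "\<alpha> p * \<alpha> p + \<beta> p * \<beta> p > 0" "\<gamma> p > 0"
proof -
  have "\<alpha> p * \<alpha> p + \<beta> p * \<beta> p = exp (2 * u p) * exp (2 * u p)
      * ((sin (2 * v p))\<^sup>2 + (cos (2 * v p))\<^sup>2)"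
    unfolding \<alpha>_def \<beta>_def by (simp only: power2_eq_square) (simp only: algebra_simps)
  then show "\<alpha> p * \<alpha> p + \<beta> p * \<beta> p > 0"
    by simp
  show "\<gamma> p > 0"
    by (simp add: \<gamma>_def)
qed

lemma conf_metric_H:
  assumes "Y \<in> V" "Z \<in> H"
  shows "g' Y Z = \<alpha> * g Y Z + \<beta> * g Y (\<phi> Z)"
  using assms by (simp add: conf_metric_eq eta_H)

lemma conf_form_metric:
  assumes Y: "Y \<in> V"
  shows "is_one_form A (\<lambda>X. g' X Y)"
  unfolding is_one_form_def
proof (intro conjI ballI)
  fix X assume X: "X \<in> V"
  show "g' X Y \<in> C"
    unfolding conf_metric_eq
    by (intro smooth_add smooth_mult smooth_diff smooth_factors metric_smooth eta_smooth phi_closed X Y)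
  show "g' (X + Z) Y = g' X Y + g' Z Y" if "Z \<in> V" for Z
    unfolding conf_metric_eq using X Y that
    by (simp add: metric_add_left phi_closed eta_add algebra_simps)
  show "g' (f \<odot> X) Y = f * g' X Y" if "f \<in> C" for f
    unfolding conf_metric_eq using X Y that
    by (simp add: metric_scale_left phi_closed eta_scale algebra_simps)
qed

text \<open>A vector orthogonal to all others is first seen to be horizontal by pairing it with \<open>\<xi>\<close>.
  On horizontal vectors the new metric is the real part of \<open>(\<alpha> + \<i> \<beta>) (g X Y - \<i> g X (\<phi> Y))\<close>; pairing with both \<open>Y\<close> and \<open>\<phi> Y\<close> gives
  the imaginary part as well, and \<open>\<alpha> + \<i> \<beta>\<close> is invertible.\<close>

lemma conf_metric_nondegenerate:
  assumes X: "X \<in> V" and null: "\<And>Y. Y \<in> V \<Longrightarrow> g' X Y p = 0" and f: "f \<in> C"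
  shows "X f p = 0"
proof (rule metric_nondegenerate[OF X _ f])
  fix Y assume Y: "Y \<in> V"
  have "\<gamma> p * \<eta> X p = 0"
    using null[OF xi_closed] X
    by (simp add: conf_metric_eq metric_xi_right phi_xi metric_zero_right eta_xi algebra_simps)
  then have eta: "\<eta> X p = 0"
    using factors_nonzero(2)[of p] by simp
  have "\<alpha> p * g X Y p + \<beta> p * g X (\<phi> Y) p = 0"
    using null[OF Y] by (simp add: conf_metric_eq eta)
  moreover have "\<alpha> p * g X (\<phi> Y) p - \<beta> p * g X Y p = 0"
    using null[OF phi_closed[OF Y]] X Y
    by (simp add: conf_metric_eq eta phi_phi metric_diff_right vf_scale_closed eta_smooth xi_closed
        metric_scale_right metric_xi_right algebra_simps)
  ultimately have "(\<alpha> p * \<alpha> p + \<beta> p * \<beta> p) * g X Y p = 0"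
    by algebra
  then show "g X Y p = 0"
    using factors_nonzero(1)[of p] by auto
qed

lemma conf_structure: "contact_B_structure A \<phi> \<xi>' \<eta>' g'"
proof
  note E = smooth_factors(4) smooth_factors(5)
  have eta_eq: "\<eta>' X = (\<lambda>p. exp (w p)) * \<eta> X" for X
    by (simp add: conf_eta_def times_fun_def)
  show "is_endo A \<phi>" by (rule endo)
  show "\<xi>' \<in> V"
    unfolding conf_xi_def by (rule vf_scale_closed[OF E(2) xi_closed])
  show "is_one_form A \<eta>'"
    unfolding is_one_form_def eta_eq
    by (auto simp: eta_add eta_scale algebra_simps intro!: smooth_mult E eta_smooth)
  show "\<phi> \<xi>' = 0"
    unfolding conf_xi_def phi_scale[OF E(2) xi_closed] phi_xi
    by (simp add: vscale_def fun_eq_iff)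
  show "\<eta>' \<xi>' = 1"
    unfolding conf_xi_def eta_eq eta_scale[OF E(2) xi_closed] eta_xi
    by (simp add: fun_eq_iff flip: exp_add)
  fix X assume X: "X \<in> V"
  show "is_one_form A (\<lambda>Z. g' Z X)"
    by (rule conf_form_metric[OF X])
  show "\<eta>' (\<phi> X) = 0"
    by (simp add: eta_eq eta_phi X)
  have "\<eta>' X \<odot> \<xi>' = \<eta> X \<odot> \<xi>"
    unfolding eta_eq conf_xi_def
    by (simp add: vscale_def fun_eq_iff exp_minus field_simps)
  then show "\<phi> (\<phi> X) = - X + \<eta>' X \<odot> \<xi>'"
    using phi_phi[OF X] by simp
  show "X f p = 0" if "\<And>Y. Y \<in> V \<Longrightarrow> g' X Y p = 0" "f \<in> C" for f p
    using X that by (rule conf_metric_nondegenerate)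
  fix Y assume Y: "Y \<in> V"
  show "g' X Y = g' Y X"
    using metric_sym[OF X Y] metric_sym[OF phi_closed[OF X] Y] metric_phi_left[OF X Y]
    by (simp add: conf_metric_eq ac_simps)
  have sq: "\<eta>' X * \<eta>' Y = \<gamma> * \<eta> X * \<eta> Y"
    by (simp add: eta_eq \<gamma>_def fun_eq_iff mult_exp_exp algebra_simps)
  show "g' (\<phi> X) (\<phi> Y) = - g' X Y + \<eta>' X * \<eta>' Y"
    unfolding sq conf_metric_eq metric_phi_phi[OF X Y] metric_phi_phi[OF X phi_closed[OF Y]]
      eta_phi[OF X] eta_phi[OF Y] eta_phi[OF phi_closed[OF Y]]
    by (simp add: algebra_simps)
qed

end

sublocale conformal_change \<subseteq> conf: contact_B_structure A \<phi> \<xi>' \<eta>' g'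
  by (rule conf_structure)

context conformal_change
begin

lemma conf_H: "conf.H = H"
  unfolding conf.H_def H_def by (auto simp: conf_eta_def fun_eq_iff)

lemma conf_metric_nonzero:
  assumes y: "y \<in> H" and z: "z \<in> H" and "g y z p \<noteq> 0"
  shows "(g' y z p)\<^sup>2 + (g' y (\<phi> z) p)\<^sup>2 > 0"
proof -
  have "(g' y z p)\<^sup>2 + (g' y (\<phi> z) p)\<^sup>2
      = (\<alpha> p * \<alpha> p + \<beta> p * \<beta> p) * ((g y z p)\<^sup>2 + (g y (\<phi> z) p)\<^sup>2)"
    using y z
    by (simp add: conf_metric_H H_closed phi_H phi_phi_H metric_uminus_right)
      (simp add: power2_eq_square algebra_simps)
  also have "\<dots> > 0"
    using factors_nonzero(1)[of p] assms(3) by (simp add: sum_power2_gt_zero_iff)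
  finally show ?thesis .
qed

end


section \<open>The difference of two natural connections\<close>

text \<open>A complex number vanishes if its product with a nonzero one does.\<close>

lemma rotation_cancel:
  fixes a b c d :: real
  assumes "c * a + d * b = 0" "c * b - d * a = 0" "a\<^sup>2 + b\<^sup>2 > 0"
  shows "c = 0" "d = 0"
proof -
  have "(a\<^sup>2 + b\<^sup>2) * c = 0" "(a\<^sup>2 + b\<^sup>2) * d = 0"
    using assms(1,2) by algebra+
  then show "c = 0" "d = 0"
    using assms(3) by auto
qed

locale natural_connection_pair = conformal_change A \<phi> \<xi> \<eta> g u v w
  for A :: "('a::{t2_space, second_countable_topology}, 'e::euclidean_space) atlas"
    and \<phi> \<xi> \<eta> g u v w +
  fixes D D' :: "'a connection"
  assumes natural: "natural_connection A \<phi> \<xi> \<eta> g D"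
    and natural': "natural_connection A \<phi> \<xi>' \<eta>' g' D'"
begin

definition Q where "Q X Y = D' X Y - D X Y"

lemmas affine = natural_affine[OF natural]
lemmas affine' = conf.natural_affine[OF natural']

lemma torsion_eq_iff: "torsion D' X Y = torsion D X Y \<longleftrightarrow> Q X Y = Q Y X"
  unfolding torsion_def Q_def by (auto simp: algebra_simps)

lemma Q_closed: "X \<in> V \<Longrightarrow> Y \<in> V \<Longrightarrow> Q X Y \<in> V"
  unfolding Q_def by (intro vf_diff_closed connection_closed[OF affine] connection_closed[OF affine'])

lemma
  assumes X: "X \<in> V" and Y: "Y \<in> V" and Z: "Z \<in> V"
  shows Q_add_left: "Q (X + Y) Z = Q X Z + Q Y Z"
    and Q_add_right: "Q X (Y + Z) = Q X Y + Q X Z"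
  unfolding Q_def connection_add_left[OF affine X Y Z] connection_add_left[OF affine' X Y Z]
    connection_add_right[OF affine X Y Z] connection_add_right[OF affine' X Y Z]
  by (simp_all add: algebra_simps)

lemma
  assumes f: "f \<in> C" and X: "X \<in> V" and Y: "Y \<in> V"
  shows Q_scale_left: "Q (f \<odot> X) Y = f \<odot> Q X Y"
    and Q_scale_right: "Q X (f \<odot> Y) = f \<odot> Q X Y"
  unfolding Q_def connection_scale_left[OF affine X Y f] connection_scale_left[OF affine' X Y f]
    connection_scale_right[OF affine X Y f] connection_scale_right[OF affine' X Y f]
  by (simp_all add: vscale_def fun_eq_iff algebra_simps)

lemma Q_uminus_left:
  assumes X: "X \<in> V" and Y: "Y \<in> V"
  shows "Q (- X) Y = - Q X Y"
  unfolding Q_def connection_uminus_left[OF affine X Y] connection_uminus_left[OF affine' X Y]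
  by simp

lemma Q_phi:
  assumes X: "X \<in> V" and Y: "Y \<in> V"
  shows "Q X (\<phi> Y) = \<phi> (Q X Y)"
  unfolding Q_def natural_phi[OF natural X Y] conf.natural_phi[OF natural' X Y]
  by (rule phi_diff[symmetric, OF connection_closed[OF affine' X Y] connection_closed[OF affine X Y]])

lemma Q_xi:
  assumes X: "X \<in> V"
  shows "Q X \<xi> = X w \<odot> \<xi>"
proof -
  have "X (\<lambda>p. exp (- w p)) \<odot> \<xi> + (\<lambda>p. exp (- w p)) \<odot> D' X \<xi> = 0"
    using conf.natural_xi[OF natural' X]
    unfolding conf_xi_def connection_scale_right[OF affine' X xi_closed smooth_factors(5)] .
  then have "exp (- w p) * (D' X \<xi> f p - X w p * \<xi> f p) = 0" for f p
    by (simp add: fun_eq_iff vscale_def vf_factors(4)[OF X] algebra_simps)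
  then show ?thesis
    unfolding Q_def natural_xi[OF natural X] by (simp add: fun_eq_iff vscale_def)
qed

lemma Q_eta:
  assumes X: "X \<in> V" and Y: "Y \<in> V"
  shows "\<eta> (Q X Y) p = X w p * \<eta> Y p"
proof -
  have "\<eta>' Z = (\<lambda>q. exp (w q)) * \<eta> Z" for Z
    by (simp add: conf_eta_def times_fun_def)
  then have "X ((\<lambda>q. exp (w q)) * \<eta> Y) = (\<lambda>q. exp (w q)) * \<eta> (D' X Y)"
    using conf.natural_eta[OF natural' X Y] by simp
  from fun_cong[OF this[unfolded vf_mult[OF X smooth_factors(4) eta_smooth[OF Y]]
        natural_eta[OF natural X Y]], of p]
  have "exp (w p) * (X w p * \<eta> Y p + \<eta> (D X Y) p - \<eta> (D' X Y) p) = 0"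
    by (simp add: vf_factors(3)[OF X] algebra_simps)
  then show ?thesis
    unfolding Q_def
    by (simp add: eta_diff connection_closed[OF affine] connection_closed[OF affine'] X Y)
qed

text \<open>Both metrics are parallel for their own connections, so that the new connection deviates from the old
  one as the factor of the new metric varies. In complex terms the symmetric part of \<open>Q X\<close> is the
  multiplication by the derivative of \<open>u + \<i> v\<close> along \<open>X\<close>, and \<open>g' y z\<close>, \<open>g' y (\<phi> z)\<close> are the real
  part and minus the imaginary part of the conformal complex metric.\<close>

lemma Q_metric:
  assumes X: "X \<in> V" and y: "y \<in> H" and z: "z \<in> H"
  shows "g' (Q X y) z p + g' (Q X z) y p = 2 * (X u p * g' y z p + X v p * g' y (\<phi> z) p)"
proof -
  note V = H_closed[OF y] H_closed[OF z] phi_closed[OF H_closed[OF z]]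
  note DH = natural_H[OF natural X y] natural_H[OF natural X z]
  note DV = connection_closed[OF affine' X V(1)] connection_closed[OF affine' X V(2)]
    H_closed[OF DH(1)] H_closed[OF DH(2)]
  have eq: "g' y z = \<alpha> * g y z + \<beta> * g y (\<phi> z)"
    by (rule conf_metric_H[OF V(1) z])
  have eq_phi: "g' y (\<phi> z) p = \<alpha> p * g y (\<phi> z) p - \<beta> p * g y z p"
    by (simp add: conf_metric_H[OF V(1) phi_H[OF V(2)]] phi_phi_H[OF z] metric_uminus_right V)
  have "X (g' y z) p = X \<alpha> p * g y z p + X \<beta> p * g y (\<phi> z) p
      + \<alpha> p * X (g y z) p + \<beta> p * X (g y (\<phi> z)) p"
    unfolding eq
    by (simp add: vf_add[OF X] vf_mult[OF X] smooth_mult smooth_factors metric_smooth V)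
  also have "X (g y z) p = g (D X y) z p + g y (D X z) p"
    using natural_metric[OF natural X V(1,2)] by simp
  also have "X (g y (\<phi> z)) p = g (D X y) (\<phi> z) p + g y (\<phi> (D X z)) p"
    using natural_metric[OF natural X V(1,3)] natural_phi[OF natural X V(2)] by simp
  finally have "X (g' y z) p = X \<alpha> p * g y z p + X \<beta> p * g y (\<phi> z) p
      + g' (D X y) z p + g' y (D X z) p"
    unfolding conf_metric_H[OF DV(3) z] conf_metric_H[OF V(1) DH(2)] by (simp add: algebra_simps)
  moreover have "X (g' y z) p = g' (D' X y) z p + g' y (D' X z) p"
    using conf.natural_metric[OF natural' X V(1,2)] by simp
  moreover have "g' (Q X y) z p = g' (D' X y) z p - g' (D X y) z p"
    unfolding Q_def conf.metric_diff_left[OF DV(1,3) V(2)] by simp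
  moreover have "g' (Q X z) y p = g' y (D' X z) p - g' y (D X z) p"
    unfolding conf.metric_sym[OF Q_closed[OF X V(2)] V(1)]
    unfolding Q_def conf.metric_diff_right[OF V(1) DV(2,4)] by simp
  ultimately have "g' (Q X y) z p + g' (Q X z) y p = X \<alpha> p * g y z p + X \<beta> p * g y (\<phi> z) p"
    by simp
  then show ?thesis
    unfolding vf_factors(1)[OF X] vf_factors(2)[OF X] eq_phi eq by (simp add: algebra_simps)
qed

lemma conf_metric_phi_phi:
  assumes "y \<in> H" "z \<in> H"
  shows "g' y (\<phi> (\<phi> z)) p = - g' y z p"
  using assms by (simp add: phi_phi_H conf.metric_uminus_right H_closed)

end


section \<open>Invariance of the torsion implies the conditions of the group\<close>

context natural_connection_pair
begin

text \<open>A symmetric \<open>Q\<close> is \<open>\<phi>\<close>-linear in its first argument because it is so in the second. By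
  the metric identity the derivative of \<open>u + \<i> v\<close> is then complex linear on horizontal fields, and
  these are the Cauchy-Riemann equations in the definition of the group. The conditions on \<open>\<xi>\<close>
  and \<open>w\<close> come from comparing \<open>Q x \<xi>\<close>, a multiple of \<open>\<xi>\<close>, with \<open>Q \<xi> x\<close>, which is
  horizontal: both vanish.\<close>

lemma in_G0_if_symmetric:
  assumes sym: "\<And>X Y. X \<in> V \<Longrightarrow> Y \<in> V \<Longrightarrow> Q X Y = Q Y X"
    and nonzero: "\<And>p. \<exists>y\<in>H. \<exists>z\<in>H. g y z p \<noteq> 0"
  shows "in_G0 A \<phi> \<xi> u v w"
proof -
  have dw: "x w = 0" if "x \<in> H" for x
  proof
    fix p
    have "\<eta> (Q x \<xi>) p = \<eta> (Q \<xi> x) p"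
      using sym[OF H_closed[OF that] xi_closed] by simp
    then show "x w p = 0 p"
      using that by (simp add: Q_eta H_closed xi_closed eta_xi eta_H)
  qed
  have Q_xi_zero: "Q \<xi> y = 0" if "y \<in> H" for y
    using sym[OF H_closed[OF that] xi_closed] Q_xi[OF H_closed[OF that]] dw[OF that]
    by (simp add: vscale_def fun_eq_iff)
  have xi: "\<xi> u p = 0 \<and> \<xi> v p = 0" for p
  proof -
    obtain y z where yz: "y \<in> H" "z \<in> H" "g y z p \<noteq> 0"
      using nonzero by blast
    have *: "\<xi> u p * g' y z p + \<xi> v p * g' y (\<phi> z) p = 0" if "z \<in> H" for z
      using Q_metric[OF xi_closed yz(1) that, of p] Q_xi_zero[OF yz(1)] Q_xi_zero[OF that]
        conf.metric_zero_right[OF H_closed[OF yz(1)]] conf.metric_zero_right[OF H_closed[OF that]]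
        conf.metric_sym[OF vf_zero H_closed[OF yz(1)]] conf.metric_sym[OF vf_zero H_closed[OF that]]
      by simp
    show ?thesis
      using rotation_cancel[OF *[OF yz(2)] _ conf_metric_nonzero[OF yz]]
        *[OF phi_H[OF H_closed[OF yz(2)]]] conf_metric_phi_phi[OF yz(1,2), of p]
      by simp
  qed
  have CR: "x u p - \<phi> x v p = 0 \<and> \<phi> x u p + x v p = 0" if x: "x \<in> H" for x p
  proof -
    obtain y z where yz: "y \<in> H" "z \<in> H" "g y z p \<noteq> 0"
      using nonzero by blast
    have *: "(\<phi> x u p + x v p) * g' y z p + (\<phi> x v p - x u p) * g' y (\<phi> z) p = 0"
      if z: "z \<in> H" for z
    proof -
      note V = H_closed[OF x] H_closed[OF yz(1)] H_closed[OF z]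
      have Q_left: "Q (\<phi> x) Y = \<phi> (Q x Y)" if "Y \<in> V" for Y
        using sym[OF phi_closed[OF V(1)] that] sym[OF V(1) that] Q_phi[OF that V(1)] by simp
      have "g' (Q (\<phi> x) y) z = g' (Q x y) (\<phi> z)"
        unfolding Q_left[OF V(2)] by (rule conf.metric_phi_left[OF Q_closed[OF V(1,2)] V(3)])
      moreover have "g' (Q (\<phi> x) z) y = g' (Q x (\<phi> z)) y"
        unfolding Q_left[OF V(3)] Q_phi[OF V(1,3)] ..
      ultimately show ?thesis
        using Q_metric[OF phi_closed[OF V(1)] yz(1) z, of p]
          Q_metric[OF V(1) yz(1) phi_H[OF V(3)], of p] conf_metric_phi_phi[OF yz(1) z, of p]
        by (simp add: algebra_simps)
    qed
    show ?thesis
      using rotation_cancel[OF *[OF yz(2)] _ conf_metric_nonzero[OF yz]]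
        *[OF phi_H[OF H_closed[OF yz(2)]]] conf_metric_phi_phi[OF yz(1,2), of p]
      by simp
  qed
  have "\<phi> (\<phi> X) u p + \<phi> X v p = 0 \<and> \<phi> X u p - \<phi> (\<phi> X) v p = 0" if "X \<in> V" for X p
    using CR[OF phi_H[OF that], of p] by simp
  then show ?thesis
    unfolding in_G0_def differential_def using xi dw[OF phi_H] by (simp add: fun_eq_iff)
qed

end


section \<open>The conditions of the group imply invariance of the torsion\<close>

text \<open>Complex linearity in the last two arguments spreads to all three: the right-hand side of \<open>tor\<close>
  keeps only the part of \<open>s\<close> that is complex linear in the first argument, so that \<open>s\<close> is itself
  complex linear there. What remains is that twice \<open>s\<close> is minus the sum of its other two cyclic
  permutations, hence all three are equal, and then four times their common value is zero.\<close>

lemma skew_form_with_torsion_identity_vanishes: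
  fixes s :: "'b \<Rightarrow> 'b \<Rightarrow> 'b \<Rightarrow> real"
  assumes J: "\<And>x. x \<in> S \<Longrightarrow> J x \<in> S"
    and skew: "\<And>x y z. x \<in> S \<Longrightarrow> y \<in> S \<Longrightarrow> z \<in> S \<Longrightarrow> s x z y = - s x y z"
    and J_move: "\<And>x y z. x \<in> S \<Longrightarrow> y \<in> S \<Longrightarrow> z \<in> S \<Longrightarrow> s x (J y) z = s x y (J z)"
    and J_J_1: "\<And>x y z. x \<in> S \<Longrightarrow> y \<in> S \<Longrightarrow> z \<in> S \<Longrightarrow> s (J (J x)) y z = - s x y z"
    and J_J_3: "\<And>x y z. x \<in> S \<Longrightarrow> y \<in> S \<Longrightarrow> z \<in> S \<Longrightarrow> s x y (J (J z)) = - s x y z"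
    and tor: "\<And>x y z. x \<in> S \<Longrightarrow> y \<in> S \<Longrightarrow> z \<in> S \<Longrightarrow>
      4 * s x y z = s y x z - s (J y) (J x) z - s z x y + s (J z) (J x) y"
    and x: "x \<in> S" and y: "y \<in> S" and z: "z \<in> S"
  shows "s x y z = 0"
proof -
  have linear: "s (J x) (J y) z = - s x y z" if "x \<in> S" "y \<in> S" "z \<in> S" for x y z
    using tor[OF J[OF that(1)] J[OF that(2)] that(3)] tor[OF that]
    by (simp add: J that J_move J_J_1 J_J_3)
  have tor': "2 * s x y z = s y x z - s z x y" if "x \<in> S" "y \<in> S" "z \<in> S" for x y z
    using tor[OF that] linear that by simp
  show ?thesis
    using tor'[OF x y z] tor'[OF y z x] tor'[OF z x y]
      skew[OF x y z] skew[OF y x z] skew[OF z x y] by simp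
qed

context natural_connection_pair
begin

lemma in_G0_facts:
  assumes G0: "in_G0 A \<phi> \<xi> u v w"
  shows G0_xi: "\<xi> u = 0" "\<xi> v = 0"
    and G0_w: "x \<in> H \<Longrightarrow> x w = 0"
    and G0_phi: "x \<in> H \<Longrightarrow> \<phi> x u p = - x v p" "x \<in> H \<Longrightarrow> \<phi> x v p = x u p"
proof -
  show "\<xi> u = 0" "\<xi> v = 0"
    using G0 by (simp_all add: in_G0_def differential_def)
  show "x w = 0" if "x \<in> H"
  proof -
    have "\<phi> (\<phi> x) w = 0"
      using G0 phi_closed[OF H_closed[OF that]] by (simp add: in_G0_def differential_def)
    then show ?thesis
      by (simp add: phi_phi_H[OF that] fun_eq_iff)
  qed
  have "\<phi> (\<phi> x) u + \<phi> x v = 0" "\<phi> x u - \<phi> (\<phi> x) v = 0" if "x \<in> H"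
    using G0 H_closed[OF that] by (simp_all add: in_G0_def differential_def)
  then show "\<phi> x u p = - x v p" "\<phi> x v p = x u p" if "x \<in> H"
    using phi_phi_H[OF that] that by (simp_all add: fun_eq_iff) (smt (verit))+
qed

text \<open>The torsion identity does not see \<open>D \<xi>\<close> on horizontal fields; the explicit formula does. In the group,
  \<open>w\<close> is constant along horizontal fields and \<open>u\<close>, \<open>v\<close> along \<open>\<xi>\<close>, so that every term of
  \<open>canonical_xi\<close> picks up the same factor \<open>exp (- w)\<close>, and the new metric is a combination
  of \<open>g y z\<close> and \<open>g y (\<phi> z)\<close> with coefficients that \<open>\<xi>\<close> does not differentiate.\<close>

lemma canonical_xi_unchanged:
  assumes G0: "in_G0 A \<phi> \<xi> u v w"
    and L: "levi_civita A g L" and formula: "phi_canonical_formula A \<phi> \<xi> \<eta> g L D"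
    and L': "levi_civita A g' L'" and formula': "phi_canonical_formula A \<phi> \<xi>' \<eta>' g' L' D'"
    and y: "y \<in> H"
  shows "Q \<xi> y = 0"
proof -
  let ?E = "\<lambda>p. exp (- w p)"
  note Vy = H_closed[OF y]
  have bracket: "lie_bracket \<xi>' x = ?E \<odot> lie_bracket \<xi> x" if x: "x \<in> H" for x
  proof -
    have "x ?E = 0"
      using G0_w[OF G0 x] vf_factors(4)[OF H_closed[OF x]] by (simp add: fun_eq_iff)
    then show ?thesis
      unfolding conf_xi_def bracket_scale_left[OF xi_closed H_closed[OF x] smooth_factors(5)]
      by (simp add: vscale_def fun_eq_iff)
  qed
  have operator: "conf.phi_linear_lie x = ?E \<odot> phi_linear_lie x" if x: "x \<in> H" for x
  proof -
    have "\<phi> (?E \<odot> lie_bracket \<xi> (\<phi> x)) = ?E \<odot> \<phi> (lie_bracket \<xi> (\<phi> x))"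
      by (rule phi_scale[OF smooth_factors(5) bracket_closed[OF xi_closed phi_closed[OF H_closed[OF x]]]])
    then show ?thesis
      unfolding conf.phi_linear_lie_def phi_linear_lie_def bracket[OF x]
        bracket[OF phi_H[OF H_closed[OF x]]]
      by (simp add: vscale_def fun_eq_iff algebra_simps)
  qed
  have DH: "D \<xi> y \<in> H" and D'V: "D' \<xi> y \<in> V"
    by (rule natural_H[OF natural xi_closed y], rule connection_closed[OF affine' xi_closed Vy])
  have "g' (D' \<xi> y) z p = g' (D \<xi> y) z p" if z: "z \<in> H" for z p
  proof -
    note Vz = H_closed[OF z]
    note O = phi_linear_lie_closed[OF Vy] phi_linear_lie_closed[OF Vz]
    have "?E p * g' (D' \<xi> y) z p = 1 / 2 * (?E p * \<xi> (g' y z) p)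
        + 1 / 4 * (?E p * g' (phi_linear_lie y) z p - ?E p * g' y (phi_linear_lie z) p)"
      using conf.canonical_xi[OF L' natural' formula', unfolded conf_H, OF y z, of p]
      unfolding operator[OF y] operator[OF z]
        conf.metric_scale_left[OF smooth_factors(5) O(1) Vz]
        conf.metric_scale_right[OF smooth_factors(5) Vy O(2)]
      unfolding conf_xi_def connection_scale_left[OF affine' xi_closed Vy smooth_factors(5)]
        conf.metric_scale_left[OF smooth_factors(5) D'V Vz]
      by (simp add: vscale_def)
    then have "?E p * (g' (D' \<xi> y) z p - (1 / 2 * \<xi> (g' y z) p
        + 1 / 4 * (g' (phi_linear_lie y) z p - g' y (phi_linear_lie z) p))) = 0"
      by (simp add: algebra_simps)
    then have conf_eq: "g' (D' \<xi> y) z p = 1 / 2 * \<xi> (g' y z) p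
        + 1 / 4 * (g' (phi_linear_lie y) z p - g' y (phi_linear_lie z) p)"
      by simp
    have "\<xi> \<alpha> p = 0" "\<xi> \<beta> p = 0"
      using vf_factors(1,2)[OF xi_closed] G0_xi[OF G0] by simp_all
    then have xi_eq: "\<xi> (g' y z) p = \<alpha> p * \<xi> (g y z) p + \<beta> p * \<xi> (g y (\<phi> z)) p"
      unfolding conf_metric_H[OF Vy z]
      by (simp add: vf_add[OF xi_closed] vf_mult[OF xi_closed] smooth_mult smooth_factors
          metric_smooth Vy Vz phi_closed)
    have op_eq: "g' (phi_linear_lie y) z p
          = \<alpha> p * g (phi_linear_lie y) z p + \<beta> p * g (phi_linear_lie y) (\<phi> z) p"
        "g' y (phi_linear_lie z) p
          = \<alpha> p * g y (phi_linear_lie z) p + \<beta> p * g y (phi_linear_lie (\<phi> z)) p"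
      unfolding conf_metric_H[OF O(1) z]
      by (simp_all add: conf_metric_eq eta_H[OF y] metric_phi_linear_lie[OF y z])
    have D_eq: "g' (D \<xi> y) z p = \<alpha> p * g (D \<xi> y) z p + \<beta> p * g (D \<xi> y) (\<phi> z) p"
      by (simp add: conf_metric_H[OF H_closed[OF DH] z])
    show ?thesis
      unfolding conf_eq xi_eq op_eq D_eq canonical_xi[OF L natural formula y z]
        canonical_xi[OF L natural formula y phi_H[OF Vz]]
      by (simp add: field_simps)
  qed
  moreover have "\<eta>' (D' \<xi> y) = \<eta>' (D \<xi> y)"
    using DH conf.natural_H[OF natural' xi_closed, unfolded conf_H, OF y]
    by (simp add: conf_eta_def eta_H)
  ultimately have "D' \<xi> y = D \<xi> y"
    by (intro conf.eq_by_horizontal D'V H_closed[OF DH]) (simp_all add: conf_H)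
  then show ?thesis
    by (simp add: Q_def)
qed

text \<open>On horizontal fields the torsion identity says that the map \<open>y \<mapsto> T x y - \<phi> (T x (\<phi> y))\<close> is
  symmetric for the metric. Modulo \<open>\<xi>\<close> this map is \<open>\<phi>\<close>-linear.
  A \<open>\<phi>\<close>-linear map that is symmetric for \<open>g\<close> is symmetric for the new metric too, so the identities
  of both connections can be subtracted from each other.\<close>

lemma horizontal_torsion_identity:
  assumes T: "phi_canonical_torsion A \<phi> \<xi> \<eta> g D"
    and T': "phi_canonical_torsion A \<phi> \<xi>' \<eta>' g' D'"
    and x: "x \<in> H" and y: "y \<in> H" and z: "z \<in> H"
  shows "2 * g' (Q x y) z p - g' (Q y x) z p + g' (Q (\<phi> y) (\<phi> x)) z p
    - 2 * g' (Q x z) y p + g' (Q z x) y p - g' (Q (\<phi> z) (\<phi> x)) y p = 0"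
proof -
  note V = H_closed[OF x] H_closed[OF y] H_closed[OF z]
  note pH = phi_H[OF V(1)] phi_H[OF V(2)] phi_H[OF V(3)]
  note pV = H_closed[OF pH(1)] H_closed[OF pH(2)] H_closed[OF pH(3)]
  note TV = torsion_closed[OF affine V(1)]
  have minus: "torsion D x (\<phi> (\<phi> z)) = - torsion D x z"
    unfolding phi_phi_H[OF z] by (rule torsion_uminus_right[OF affine V(1,3)])
  (* The identity at y, z and the one at y, phi z, weighted by the two factors of the new metric. *)
  have T_conf: "g' (torsion D x y) z p - g' (torsion D x (\<phi> y)) (\<phi> z) p
    - g' (torsion D x z) y p + g' (torsion D x (\<phi> z)) (\<phi> y) p = 0"
    using canonical_torsion_H[OF T x y z, of p] canonical_torsion_H[OF T x y pH(3), of p]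
    unfolding conf_metric_H[OF TV[OF V(2)] z] conf_metric_H[OF TV[OF V(3)] y]
      conf_metric_H[OF TV[OF pV(2)] pH(3)] conf_metric_H[OF TV[OF pV(3)] pH(2)] minus
    unfolding phi_phi_H[OF z] phi_phi_H[OF y]
    by (simp add: metric_uminus_right metric_uminus_left TV V pV) algebra
  have diff: "g' (torsion D' x a) b p - g' (torsion D x a) b p = g' (Q x a) b p - g' (Q a x) b p"
    if a: "a \<in> V" and b: "b \<in> V" for a b
  proof -
    have "torsion D' x a - torsion D x a = Q x a - Q a x"
      by (simp add: torsion_def Q_def)
    then have "g' (torsion D' x a - torsion D x a) b = g' (Q x a - Q a x) b"
      by simp
    then show ?thesis
      unfolding conf.metric_diff_left[OF torsion_closed[OF affine' V(1) a] TV[OF a] b]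
        conf.metric_diff_left[OF Q_closed[OF V(1) a] Q_closed[OF a V(1)] b]
      by (simp add: fun_eq_iff)
  qed
  have move: "g' (Q c (\<phi> a)) b = g' (Q c a) (\<phi> b)" if "c \<in> V" "a \<in> V" "b \<in> V" for a b c
    unfolding Q_phi[OF that(1,2)] by (rule conf.metric_phi_left[OF Q_closed[OF that(1,2)] that(3)])
  have move2: "g' (Q x (\<phi> y)) (\<phi> z) p = - g' (Q x y) z p"
      "g' (Q x (\<phi> z)) (\<phi> y) p = - g' (Q x z) y p"
    unfolding move[OF V(1,2) pV(3)] move[OF V(1,3) pV(2)] phi_phi_H[OF y] phi_phi_H[OF z]
    by (simp_all add: conf.metric_uminus_right Q_closed V)
  show ?thesis
    using conf.canonical_torsion_H[OF T', unfolded conf_H, OF x y z, of p] T_conf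
      diff[OF V(2,3)] diff[OF V(3,2)] diff[OF pV(2,3)] diff[OF pV(3,2)] move2
      fun_cong[OF move[OF pV(2) V(1,3)], of p] fun_cong[OF move[OF pV(3) V(1,2)], of p]
    by argo
qed

text \<open>The metric identity fixes the part of \<open>Q\<close> that is symmetric in the last two arguments. As for the
  Christoffel symbols, exactly one such tensor is also symmetric in the first two, and in the group it is
  complex linear in all arguments, hence satisfies the torsion identity. The deviation \<open>s\<close> of \<open>Q\<close>
  from it is therefore skew and satisfies that identity, and vanishes.\<close>

lemma horizontal_symmetric:
  assumes G0: "in_G0 A \<phi> \<xi> u v w"
    and T: "phi_canonical_torsion A \<phi> \<xi> \<eta> g D"
    and T': "phi_canonical_torsion A \<phi> \<xi>' \<eta>' g' D'"
    and x: "x \<in> H" and y: "y \<in> H"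
  shows "Q x y = Q y x"
proof -
  have "g' (Q x y) z p = g' (Q y x) z p" if z: "z \<in> H" for z p
  proof -
    define q where "q = (\<lambda>x y z. g' (Q x y) z p)"
    define m where "m = (\<lambda>x y z. 2 * (x u p * g' y z p + x v p * g' y (\<phi> z) p))"
    define s where "s = (\<lambda>x y z. q x y z - (m x y z + m y x z - m z x y) / 2)"
    note [simp] = H_closed phi_H
    have q_metric: "q x y z + q x z y = m x y z" if "x \<in> H" "y \<in> H" "z \<in> H" for x y z
      unfolding q_def m_def using that by (intro Q_metric) simp_all
    have q_move: "q x (\<phi> y) z = q x y (\<phi> z)" if "x \<in> H" "y \<in> H" "z \<in> H" for x y z
      using that by (simp add: q_def Q_phi conf.metric_phi_left Q_closed)
    have q_1: "q (\<phi> (\<phi> x)) y z = - q x y z" if "x \<in> H" "y \<in> H" "z \<in> H" for x y z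
      using that by (simp add: q_def phi_phi_H Q_uminus_left conf.metric_uminus_left Q_closed)
    have q_3: "q x y (\<phi> (\<phi> z)) = - q x y z" if "x \<in> H" "y \<in> H" "z \<in> H" for x y z
      using that by (simp add: q_def phi_phi_H conf.metric_uminus_right Q_closed)
    have m_sym: "m x z y = m x y z" if "x \<in> H" "y \<in> H" "z \<in> H" for x y z
      using that conf.metric_sym[of y z] conf.metric_sym[of "\<phi> y" z] conf.metric_phi_left[of y z]
      by (simp add: m_def)
    have m_move: "m x (\<phi> y) z = m x y (\<phi> z)" if "x \<in> H" "y \<in> H" "z \<in> H" for x y z
      using that by (simp add: m_def conf.metric_phi_left)
    have m_CR: "m (\<phi> x) y z = m x y (\<phi> z)" if "x \<in> H" "y \<in> H" "z \<in> H" for x y z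
      using that by (simp add: m_def G0_phi[OF G0] conf_metric_phi_phi)
    have m_3: "m x y (\<phi> (\<phi> z)) = - m x y z" if "x \<in> H" "y \<in> H" "z \<in> H" for x y z
      using that conf_metric_phi_phi[of y z p] conf_metric_phi_phi[of y "\<phi> z" p] by (simp add: m_def)
    have s_zero: "s x y z = 0" if xyz: "x \<in> H" "y \<in> H" "z \<in> H" for x y z
    proof (rule skew_form_with_torsion_identity_vanishes[where S = H and J = \<phi> and s = s])
      fix x y z assume H: "x \<in> H" "y \<in> H" "z \<in> H"
      show "s x z y = - s x y z"
        using q_metric[OF H] m_sym[OF H] m_sym[OF H(2,1,3)] m_sym[OF H(3,1,2)]
        by (simp add: s_def field_simps)
      show "s x (\<phi> y) z = s x y (\<phi> z)"
        using H by (simp add: s_def q_move m_move m_CR)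
      show "s (\<phi> (\<phi> x)) y z = - s x y z"
        using H by (simp add: s_def q_1 m_move m_CR m_3 field_simps)
      show "s x y (\<phi> (\<phi> z)) = - s x y z"
        using H by (simp add: s_def q_3 m_move m_CR m_3 field_simps)
      have "2 * q x y z - q y x z + q (\<phi> y) (\<phi> x) z - 2 * q x z y + q z x y - q (\<phi> z) (\<phi> x) y = 0"
        unfolding q_def by (rule horizontal_torsion_identity[OF T T' H])
      then show "4 * s x y z = s y x z - s (\<phi> y) (\<phi> x) z - s z x y + s (\<phi> z) (\<phi> x) y"
        using q_metric[OF H] m_sym[OF H] m_sym[OF H(2,1,3)] m_sym[OF H(3,1,2)] H
        by (simp add: s_def m_move m_CR m_3 field_simps)
    qed (use xyz in auto)
    have "q x y z = q y x z"
      using s_zero[OF x y z] s_zero[OF y x z] m_sym[OF z x y] by (simp add: s_def)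
    then show ?thesis
      by (simp add: q_def)
  qed
  moreover have "\<eta>' (Q x y) = \<eta>' (Q y x)"
    using x y by (simp add: conf_eta_def Q_eta H_closed eta_H)
  ultimately show ?thesis
    using x y by (intro conf.eq_by_horizontal Q_closed) (simp_all add: conf_H H_closed)
qed

text \<open>\<open>Q\<close> is a tensor, and the horizontal fields together with \<open>\<xi>\<close> span all fields.\<close>

lemma symmetric_if_symmetric_on_parts:
  assumes xi: "\<And>y. y \<in> H \<Longrightarrow> Q \<xi> y = 0"
    and w: "\<And>x. x \<in> H \<Longrightarrow> x w = 0"
    and hor: "\<And>x y. x \<in> H \<Longrightarrow> y \<in> H \<Longrightarrow> Q x y = Q y x"
    and X: "X \<in> V" and Y: "Y \<in> V"
  shows "Q X Y = Q Y X"
proof -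
  have split: "Q W Z = Q (- \<phi> (\<phi> W)) Z + \<eta> W \<odot> Q \<xi> Z"
      "Q Z W = Q Z (- \<phi> (\<phi> W)) + \<eta> W \<odot> Q Z \<xi>" if W: "W \<in> V" and Z: "Z \<in> V" for W Z
  proof -
    note parts = H_closed[OF decompose(2)[OF W]]
      vf_scale_closed[OF eta_smooth[OF W] xi_closed]
    show "Q W Z = Q (- \<phi> (\<phi> W)) Z + \<eta> W \<odot> Q \<xi> Z"
      using Q_add_left[OF parts Z] Q_scale_left[OF eta_smooth[OF W] xi_closed Z]
        decompose(1)[OF W] by metis
    show "Q Z W = Q Z (- \<phi> (\<phi> W)) + \<eta> W \<odot> Q Z \<xi>"
      using Q_add_right[OF Z parts] Q_scale_right[OF eta_smooth[OF W] Z xi_closed]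
        decompose(1)[OF W] by metis
  qed
  have xi_right: "Q x \<xi> = 0" if "x \<in> H" for x
    using Q_xi[OF H_closed[OF that]] w[OF that] by (simp add: vscale_def fun_eq_iff)
  have xi_sym: "Q \<xi> Z = Q Z \<xi>" if Z: "Z \<in> V" for Z
    using split[OF Z xi_closed] xi[OF decompose(2)[OF Z]] xi_right[OF decompose(2)[OF Z]] by simp
  have "Q x Z = Q Z x" if x: "x \<in> H" and Z: "Z \<in> V" for x Z
    using split[OF Z H_closed[OF x]] hor[OF decompose(2)[OF Z] x] xi[OF x] xi_right[OF x] by simp
  then show ?thesis
    using split[OF X Y] decompose(2)[OF X] Y xi_sym[OF Y] by simp
qed

end


section \<open>Invariance of the torsion\<close>

lemma almost_contact_B_metric_structure:
  assumes "almost_contact_B_metric A n \<phi> \<xi> \<eta> g"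
  shows "contact_B_structure A \<phi> \<xi> \<eta> g"
  using assms unfolding almost_contact_B_metric_def pseudo_riemannian_metric_def
  by unfold_locales blast+

theorem theorem5p9:
  fixes A :: "('a::{t2_space, second_countable_topology}, 'e::euclidean_space) atlas"
    and n :: nat
    and \<phi> :: "'a endo" and \<xi> :: "'a vfield" and \<eta> :: "'a one_form" and g :: "'a bilin"
    and u v w :: "'a \<Rightarrow> real"
    and D D' :: "'a connection"
  assumes "n \<ge> 1"
    and "almost_contact_B_metric A n \<phi> \<xi> \<eta> g"
    and "u \<in> smooth_fns A" and "v \<in> smooth_fns A" and "w \<in> smooth_fns A"
    and "phi_canonical_connection A \<phi> \<xi> \<eta> g D"
    and "phi_canonical_connection A \<phi> (conf_xi w \<xi>) (conf_eta w \<eta>) (conf_metric u v w \<phi> \<eta> g) D'"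
  shows "(\<forall>X\<in>vfields A. \<forall>Y\<in>vfields A. torsion D' X Y = torsion D X Y) \<longleftrightarrow> in_G0 A \<phi> \<xi> u v w"
proof -
  interpret contact_B_structure A \<phi> \<xi> \<eta> g
    by (rule almost_contact_B_metric_structure[OF assms(2)])
  interpret natural_connection_pair A \<phi> \<xi> \<eta> g u v w D D'
    using assms(3-7) by unfold_locales (simp_all add: phi_canonical_connection_def)
  obtain L L' where L: "levi_civita A g L" "phi_canonical_formula A \<phi> \<xi> \<eta> g L D"
    and L': "levi_civita A g' L'" "phi_canonical_formula A \<phi> \<xi>' \<eta>' g' L' D'"
    using assms(6,7) by (auto simp: phi_canonical_connection_def)
  have T: "phi_canonical_torsion A \<phi> \<xi> \<eta> g D" "phi_canonical_torsion A \<phi> \<xi>' \<eta>' g' D'"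
    using assms(6,7) by (simp_all add: phi_canonical_connection_def)
  have nonzero: "\<exists>y\<in>H. \<exists>z\<in>H. g y z p \<noteq> 0" for p
  proof -
    obtain E where E: "\<And>i. i < n + 1 + n \<Longrightarrow> E i \<in> V"
      "\<And>i j. i < n + 1 + n \<Longrightarrow> j < n + 1 + n \<Longrightarrow>
        g (E i) (E j) p = (if i \<noteq> j then 0 else if i < n + 1 then 1 else - 1)"
      using assms(2) unfolding almost_contact_B_metric_def pseudo_riemannian_metric_def by metis
    (* n >= 1 makes the frame long enough to contain two vectors *)
    show ?thesis
      using metric_nonzero_on_horizontal[of "E 0" "E 1" p] E \<open>n \<ge> 1\<close> by simp
  qed
  show ?thesis
    unfolding torsion_eq_iff
  proof
    assume "\<forall>X\<in>V. \<forall>Y\<in>V. Q X Y = Q Y X"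
    then show "in_G0 A \<phi> \<xi> u v w"
      using in_G0_if_symmetric nonzero by blast
  next
    assume G0: "in_G0 A \<phi> \<xi> u v w"
    show "\<forall>X\<in>V. \<forall>Y\<in>V. Q X Y = Q Y X"
      using symmetric_if_symmetric_on_parts canonical_xi_unchanged[OF G0 L L'] G0_w[OF G0]
        horizontal_symmetric[OF G0 T] by blast
  qed
qed

end
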